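(* Let $p\geq 1$ be an integer, $n=2p+1$, $K=\mathbb{Q}(x^1,\dots,x^n)$ with its standard derivations, and $D=K[d_1,\dots,d_n]$. Let $M$ be the differential module over $D$ defined by the Lie operator of infinitesimal contact transformations, i.e. by the linear system expressing that the Lie derivative $\mathcal{L}(\xi)\alpha$ is proportional to $\alpha$, where $$\alpha=dx^n-\sum_{a=1}^{p}x^{\bar{a}}\,dx^{a},\qquad \bar{a}=a+p .$$ Then $ext^i_D(M,D)=0$ for all $i\geq 1$.
   Context: $D=K[d_1,\dots,d_n]$ is the non-commutative ring of linear differential operators with coefficients in $K$, with $d_id_j=d_jd_i$ and $d_ia=ad_i+\partial_ia$ for $a\in K$. The system of infinitesimal contact transformations has unknowns $\xi=(\xi^1,\dots,\xi^n)$, the components of a vector field $\xi=\xi^i\partial_i$. It is obtained by eliminating the factor $\rho$ from $\mathcal{L}(\xi)\alpha=\rho\,\alpha$. Writing $\alpha=\alpha_idx^i$ and $(\mathcal{L}(\xi)\alpha)_i=\alpha_r\partial_i\xi^r+\xi^r\partial_r\alpha_i$ (summation over $r$), the system consists of the linear homogeneous first order equations $\alpha_j(\mathcal{L}(\xi)\alpha)_i-\alpha_i(\mathcal{L}(\xi)\alpha)_j=0$ for all $i,j$. The differential module $M$ defined by a linear system in unknowns $\xi^1,\dots,\xi^n$ is the left $D$-module quotient of the free module $D\xi^1+\dots+D\xi^n\simeq D^n$ by the submodule generated by the equations of the system, where $\partial_i$ acting on an unknown is replaced by $d_i$. *)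

theory Defs
  imports
    "HOL-Library.Poly_Mapping"
    "HOL-Computational_Algebra.Fraction_Field"
    "HOL-Algebra.Algebra"
begin

section \<open>Rational functions and their derivations\<close>

text \<open>
  A polynomial over \<open>\<rat>\<close> in the variables \<open>x\<^sup>0, x\<^sup>1, \<dots>\<close> maps exponent vectors to coefficients.
\<close>

type_synonym mpoly_rat = "(nat \<Rightarrow>\<^sub>0 nat) \<Rightarrow>\<^sub>0 rat"
type_synonym ratfun = "mpoly_rat fract"

abbreviation unit_exp :: "nat \<Rightarrow> (nat \<Rightarrow>\<^sub>0 nat)" where
  "unit_exp i \<equiv> Poly_Mapping.single i 1"

definition mpoly_vars :: "mpoly_rat \<Rightarrow> nat set" where
  "mpoly_vars f = (\<Union>m\<in>Poly_Mapping.keys f. Poly_Mapping.keys m)"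

definition mpoly_deriv :: "nat \<Rightarrow> mpoly_rat \<Rightarrow> mpoly_rat" where
  "mpoly_deriv i f = (\<Sum>m\<in>Poly_Mapping.keys f.
     Poly_Mapping.single (m - unit_exp i) (of_nat (Poly_Mapping.lookup m i) * Poly_Mapping.lookup f m))"

definition ratfuns :: "nat \<Rightarrow> ratfun set" where
  "ratfuns n = {Fraction_Field.Fract f g | f g. g \<noteq> 0 \<and> mpoly_vars f \<subseteq> {1..n} \<and> mpoly_vars g \<subseteq> {1..n}}"

definition coord :: "nat \<Rightarrow> ratfun" where
  "coord i = Fraction_Field.Fract (Poly_Mapping.single (unit_exp i) 1) 1"

lemma lookup_mpoly_deriv:
  "Poly_Mapping.lookup (mpoly_deriv i f) m =
     of_nat (Poly_Mapping.lookup m i + 1) * Poly_Mapping.lookup f (m + unit_exp i)"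
proof -
  have *: "(of_nat (Poly_Mapping.lookup k i) * Poly_Mapping.lookup f k when k - unit_exp i = m)
      = (of_nat (Poly_Mapping.lookup k i) * Poly_Mapping.lookup f k when k = m + unit_exp i)" for k
  proof (cases "Poly_Mapping.lookup k i = 0")
    case False
    have "k - unit_exp i = m \<longleftrightarrow> k = m + unit_exp i"
    proof
      assume "k - unit_exp i = m"
      then show "k = m + unit_exp i"
        using False by (auto intro!: poly_mapping_eqI simp: lookup_add lookup_minus lookup_single when_def)
    qed simp
    then show ?thesis by simp
  qed simp
  have "Poly_Mapping.lookup (mpoly_deriv i f) m
     = (\<Sum>k\<in>Poly_Mapping.keys f. of_nat (Poly_Mapping.lookup k i) * Poly_Mapping.lookup f k
          when k = m + unit_exp i)"
    by (simp add: mpoly_deriv_def lookup_sum lookup_single * del: One_nat_def)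
  also have "\<dots> = of_nat (Poly_Mapping.lookup m i + 1) * Poly_Mapping.lookup f (m + unit_exp i)"
    by (auto simp: when_def in_keys_iff lookup_add)
  finally show ?thesis .
qed

lemma mpoly_deriv_add: "mpoly_deriv i (f + g) = mpoly_deriv i f + mpoly_deriv i g"
  by (rule poly_mapping_eqI) (simp add: lookup_mpoly_deriv lookup_add algebra_simps)

lemma mpoly_deriv_0 [simp]: "mpoly_deriv i 0 = 0"
  by (simp add: mpoly_deriv_def)

lemma mpoly_deriv_single:
  "mpoly_deriv i (Poly_Mapping.single m c) =
     Poly_Mapping.single (m - unit_exp i) (of_nat (Poly_Mapping.lookup m i) * c)"
  by (cases "c = 0") (simp_all add: mpoly_deriv_def)

lemma poly_mapping_single_induct [case_names zero single add]:
  fixes p :: "'a \<Rightarrow>\<^sub>0 'b::monoid_add"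
  assumes zero: "P 0" and single: "\<And>k c. P (Poly_Mapping.single k c)"
    and add: "\<And>p q. P p \<Longrightarrow> P q \<Longrightarrow> P (p + q)"
  shows "P p"
proof (induction p rule: update_induct)
  case (update f a b)
  have "Poly_Mapping.update a b f = Poly_Mapping.single a b + f"
    using update.hyps
    by (intro poly_mapping_eqI) (auto simp: lookup_update lookup_add lookup_single when_def in_keys_iff)
  then show ?case using add[OF single update.IH] by simp
qed (rule zero)

lemma mpoly_deriv_mult: "mpoly_deriv i (f * g) = mpoly_deriv i f * g + f * mpoly_deriv i g"
proof (induction f rule: poly_mapping_single_induct)
  case (single m a)
  show ?case
  proof (induction g rule: poly_mapping_single_induct)
    case (single n b)
    have *: "Poly_Mapping.single (m + n - unit_exp i) (of_nat (Poly_Mapping.lookup m i) * c)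
        = Poly_Mapping.single (m - unit_exp i + n) (of_nat (Poly_Mapping.lookup m i) * c)"
      for m n :: "nat \<Rightarrow>\<^sub>0 nat" and c :: rat
    proof (cases "Poly_Mapping.lookup m i = 0")
      case False
      then have "m + n - unit_exp i = m - unit_exp i + n"
        by (intro poly_mapping_eqI) (auto simp: lookup_add lookup_minus lookup_single when_def)
      then show ?thesis by simp
    qed simp
    show ?case
      using *[of m n "a * b"] *[of n m "a * b"]
      by (simp add: mpoly_deriv_single mult_single lookup_add ring_distribs single_add
          algebra_simps)
  qed (simp_all add: mpoly_deriv_add algebra_simps)
qed (simp_all add: mpoly_deriv_add algebra_simps)

lemma mpoly_deriv_commute: "mpoly_deriv i (mpoly_deriv j f) = mpoly_deriv j (mpoly_deriv i f)"
  by (rule poly_mapping_eqI) (auto simp: lookup_mpoly_deriv lookup_add lookup_single when_def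
      algebra_simps)

lemma quotient_rule_wd:
  fixes f g f' g' df dg df' dg' :: "'a::comm_ring_1"
  assumes "f * g' = f' * g" "df * g' + f * dg' = df' * g + f' * dg"
  shows "(df * g - f * dg) * (g' * g') = (df' * g' - f' * dg') * (g * g)"
proof -
  have "(df * g - f * dg) * (g' * g') = g * g' * (df * g' + f * dg') - g * dg' * (f * g') - g' * dg * (f * g')"
    by (simp add: algebra_simps)
  also have "\<dots> = (df' * g' - f' * dg') * (g * g)"
    unfolding assms by (simp add: algebra_simps)
  finally show ?thesis .
qed

text \<open>
  The quotient rule, applied to some representative of the fraction; by \<open>pd_Fract\<close> below the choice
  does not matter.
\<close>

definition pd :: "nat \<Rightarrow> ratfun \<Rightarrow> ratfun" where
  "pd i a = (case rep_fract a of (f, g) \<Rightarrow>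
     Fraction_Field.Fract (mpoly_deriv i f * g - f * mpoly_deriv i g) (g * g))"

lemma rep_fract_Fract:
  assumes "g \<noteq> 0" "rep_fract (Fraction_Field.Fract f g) = (f', g')"
  shows "g' \<noteq> 0" "f * g' = f' * g"
proof -
  have "abs_fract (f, g) = Fraction_Field.Fract f g"
    using assms(1) by (simp add: Fraction_Field.Fract.abs_eq)
  then have "fractrel (rep_fract (Fraction_Field.Fract f g)) (f, g)"
    using rep_abs_rsp_left[OF Quotient3_fract, of "(f, g)" "(f, g)"] assms(1) by simp
  then show "g' \<noteq> 0" "f * g' = f' * g"
    using assms(2) by auto
qed

lemma pd_Fract:
  assumes "g \<noteq> 0"
  shows "pd i (Fraction_Field.Fract f g) =
    Fraction_Field.Fract (mpoly_deriv i f * g - f * mpoly_deriv i g) (g * g)"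
proof -
  obtain f' g' where r: "rep_fract (Fraction_Field.Fract f g) = (f', g')"
    by fastforce
  have g': "g' \<noteq> 0" and e: "f * g' = f' * g"
    using rep_fract_Fract[OF assms r] by blast+
  then have "mpoly_deriv i (f * g') = mpoly_deriv i (f' * g)" by simp
  then have d: "mpoly_deriv i f * g' + f * mpoly_deriv i g'
      = mpoly_deriv i f' * g + f' * mpoly_deriv i g"
    by (simp only: mpoly_deriv_mult)
  show ?thesis
    using quotient_rule_wd[OF e d] assms g'
    by (simp only: pd_def r prod.case Fraction_Field.eq_fract mult_eq_0_iff simp_thms)
qed

lemma quotient_rule_add:
  fixes f g f' g' df dg df' dg' :: "'a::comm_ring_1"
  shows "((df * g' + f * dg' + (df' * g + f' * dg)) * (g * g')
      - (f * g' + f' * g) * (dg * g' + g * dg')) * ((g * g) * (g' * g'))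
    = ((df * g - f * dg) * (g' * g') + (df' * g' - f' * dg') * (g * g)) * ((g * g') * (g * g'))"
    (is "?X * ?A = ?Y * ?B")
proof -
  have "?X = ?Y" by (simp add: algebra_simps)
  moreover have "?A = ?B" by (simp add: ac_simps)
  ultimately show ?thesis by (simp only:)
qed

lemma quotient_rule_mult:
  fixes f g f' g' df dg df' dg' :: "'a::comm_ring_1"
  shows "((df * f' + f * df') * (g * g') - (f * f') * (dg * g' + g * dg'))
      * (((g * g) * g') * (g * (g' * g')))
    = (((df * g - f * dg) * f') * (g * (g' * g')) + (f * (df' * g' - f' * dg')) * ((g * g) * g'))
      * ((g * g') * (g * g'))" (is "?X * ?A = ?Y * ?B")
proof -
  let ?Z = "(df * g - f * dg) * f' * g' + f * (df' * g' - f' * dg') * g"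
  have X: "?X = ?Z" by (simp add: algebra_simps)
  have Y: "?Y = ?Z * (g * g')" by (simp only: distrib_left distrib_right ac_simps)
  have A: "?A = (g * g') * ?B" by (simp only: ac_simps)
  show ?thesis unfolding X Y A by (simp only: mult.assoc)
qed

lemma pd_add: "pd i (a + b) = pd i a + pd i b"
proof (cases a; cases b)
  fix f g f' g' assume *: "a = Fraction_Field.Fract f g" "g \<noteq> 0" "b = Fraction_Field.Fract f' g'" "g' \<noteq> 0"
  then show ?thesis
    unfolding * by (simp only: pd_Fract Fraction_Field.add_fract mpoly_deriv_add mpoly_deriv_mult
        mult_eq_0_iff simp_thms Fraction_Field.eq_fract quotient_rule_add)
qed

lemma pd_mult: "pd i (a * b) = pd i a * b + a * pd i b"
proof (cases a; cases b)
  fix f g f' g' assume *: "a = Fraction_Field.Fract f g" "g \<noteq> 0" "b = Fraction_Field.Fract f' g'" "g' \<noteq> 0"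
  then show ?thesis
    unfolding * by (simp only: pd_Fract Fraction_Field.add_fract Fraction_Field.mult_fract
        mpoly_deriv_add mpoly_deriv_mult mult_eq_0_iff simp_thms Fraction_Field.eq_fract
        quotient_rule_mult)
qed

lemma pd_0 [simp]: "pd i 0 = 0"
  by (metis add_cancel_right_left pd_add add_0)

lemma pd_1 [simp]: "pd i 1 = 0"
  by (metis add_cancel_right_left pd_mult mult_1 mult_1_right)

lemma pd_minus: "pd i (- a) = - pd i a"
  using pd_add[of i a "- a"] by (simp add: add_eq_0_iff)

lemma mpoly_deriv_diff: "mpoly_deriv i (f - g) = mpoly_deriv i f - mpoly_deriv i g"
  using mpoly_deriv_add[of i "f - g" g] by (simp add: algebra_simps)

lemma quotient_rule_commute:
  fixes f g fi fj fij gi gj gij :: "'a::comm_ring_1"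
  shows "((fij * g + fj * gi - (fi * gj + f * gij)) * (g * g)
      - (fj * g - f * gj) * (gi * g + g * gi))
    = ((fij * g + fi * gj - (fj * gi + f * gij)) * (g * g)
      - (fi * g - f * gi) * (gj * g + g * gj))"
  by (simp add: algebra_simps)

lemma pd_commute: "pd i (pd j a) = pd j (pd i a)"
proof (cases a)
  fix f g assume *: "a = Fraction_Field.Fract f g" "g \<noteq> 0"
  then show ?thesis
    unfolding * by (simp only: pd_Fract mpoly_deriv_diff mpoly_deriv_mult mult_eq_0_iff simp_thms
        mpoly_deriv_commute[of j i] quotient_rule_commute)
qed

lemma pd_coord: "pd i (coord j) = (if i = j then 1 else 0)"
proof -
  have "mpoly_deriv i 1 = 0"
    using mpoly_deriv_single[of i 0 1] by simp
  then show ?thesis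
    by (simp add: coord_def pd_Fract mpoly_deriv_single lookup_single when_def
        Fraction_Field.One_fract_def Fraction_Field.Zero_fract_def)
qed


subsection \<open>The subfield of rational functions in the first variables\<close>

lemma mpoly_vars_add: "mpoly_vars (f + g) \<subseteq> mpoly_vars f \<union> mpoly_vars g"
  unfolding mpoly_vars_def using Poly_Mapping.keys_add[of f g] by auto

lemma mpoly_vars_minus [simp]: "mpoly_vars (- f) = mpoly_vars f"
  by (simp add: mpoly_vars_def in_keys_iff Poly_Mapping.keys.rep_eq)

lemma mpoly_vars_mult: "mpoly_vars (f * g) \<subseteq> mpoly_vars f \<union> mpoly_vars g"
proof -
  { fix m assume "m \<in> Poly_Mapping.keys (f * g)"
    then obtain a b where "a \<in> Poly_Mapping.keys f" "b \<in> Poly_Mapping.keys g" "m = a + b"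
      using keys_mult[of f g] by blast
    then have "Poly_Mapping.keys m \<subseteq> mpoly_vars f \<union> mpoly_vars g"
      using Poly_Mapping.keys_add[of a b] unfolding mpoly_vars_def by blast }
  then show ?thesis unfolding mpoly_vars_def[of "f * g"] by blast
qed

lemma mpoly_vars_deriv: "mpoly_vars (mpoly_deriv i f) \<subseteq> mpoly_vars f"
proof -
  { fix m assume "m \<in> Poly_Mapping.keys (mpoly_deriv i f)"
    then have "m + unit_exp i \<in> Poly_Mapping.keys f"
      by (auto simp: in_keys_iff lookup_mpoly_deriv)
    moreover have "Poly_Mapping.keys m \<subseteq> Poly_Mapping.keys (m + unit_exp i)"
      by (auto simp: in_keys_iff lookup_add)
    ultimately have "Poly_Mapping.keys m \<subseteq> mpoly_vars f"
      unfolding mpoly_vars_def by blast }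
  then show ?thesis unfolding mpoly_vars_def[of "mpoly_deriv i f"] by blast
qed

lemma mpoly_vars_1 [simp]: "mpoly_vars 1 = {}"
  by (simp add: mpoly_vars_def)

lemma mpoly_vars_0 [simp]: "mpoly_vars 0 = {}"
  by (simp add: mpoly_vars_def)

lemma ratfunsI:
  "g \<noteq> 0 \<Longrightarrow> mpoly_vars f \<subseteq> {1..n} \<Longrightarrow> mpoly_vars g \<subseteq> {1..n} \<Longrightarrow> Fraction_Field.Fract f g \<in> ratfuns n"
  unfolding ratfuns_def by blast

lemma ratfuns_0 [simp]: "0 \<in> ratfuns n"
  by (auto simp: Fraction_Field.Zero_fract_def intro!: ratfunsI)

lemma ratfuns_1 [simp]: "1 \<in> ratfuns n"
  by (auto simp: Fraction_Field.One_fract_def intro!: ratfunsI)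

lemma ratfunsE:
  assumes "a \<in> ratfuns n"
  obtains f g where "a = Fraction_Field.Fract f g" "g \<noteq> 0"
    "mpoly_vars f \<subseteq> {1..n}" "mpoly_vars g \<subseteq> {1..n}"
  using assms unfolding ratfuns_def by blast

lemma ratfuns_add [intro]:
  assumes "a \<in> ratfuns n" "b \<in> ratfuns n"
  shows "a + b \<in> ratfuns n"
proof -
  obtain f g where fg: "a = Fraction_Field.Fract f g" "g \<noteq> 0"
      "mpoly_vars f \<subseteq> {1..n}" "mpoly_vars g \<subseteq> {1..n}"
    using assms(1) by (rule ratfunsE)
  obtain f' g' where fg': "b = Fraction_Field.Fract f' g'" "g' \<noteq> 0"
      "mpoly_vars f' \<subseteq> {1..n}" "mpoly_vars g' \<subseteq> {1..n}"
    using assms(2) by (rule ratfunsE)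
  have "mpoly_vars (f * g' + f' * g) \<subseteq> {1..n}"
    using mpoly_vars_add[of "f * g'" "f' * g"] mpoly_vars_mult[of f g'] mpoly_vars_mult[of f' g]
      fg(3,4) fg'(3,4) by blast
  moreover have "mpoly_vars (g * g') \<subseteq> {1..n}"
    using mpoly_vars_mult[of g g'] fg(4) fg'(4) by blast
  moreover have "a + b = Fraction_Field.Fract (f * g' + f' * g) (g * g')"
    unfolding fg(1) fg'(1) using fg(2) fg'(2) by (rule Fraction_Field.add_fract)
  ultimately show ?thesis
    using fg(2) fg'(2) by (simp add: ratfunsI)
qed

lemma ratfuns_mult [intro]:
  assumes "a \<in> ratfuns n" "b \<in> ratfuns n"
  shows "a * b \<in> ratfuns n"
proof -
  obtain f g where fg: "a = Fraction_Field.Fract f g" "g \<noteq> 0"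
      "mpoly_vars f \<subseteq> {1..n}" "mpoly_vars g \<subseteq> {1..n}"
    using assms(1) by (rule ratfunsE)
  obtain f' g' where fg': "b = Fraction_Field.Fract f' g'" "g' \<noteq> 0"
      "mpoly_vars f' \<subseteq> {1..n}" "mpoly_vars g' \<subseteq> {1..n}"
    using assms(2) by (rule ratfunsE)
  have "mpoly_vars (f * f') \<subseteq> {1..n}"
    using mpoly_vars_mult[of f f'] fg(3) fg'(3) by blast
  moreover have "mpoly_vars (g * g') \<subseteq> {1..n}"
    using mpoly_vars_mult[of g g'] fg(4) fg'(4) by blast
  moreover have "a * b = Fraction_Field.Fract (f * f') (g * g')"
    unfolding fg(1) fg'(1) by (rule Fraction_Field.mult_fract)
  ultimately show ?thesis
    using fg(2) fg'(2) by (simp add: ratfunsI)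
qed

lemma ratfuns_uminus [intro]: "a \<in> ratfuns n \<Longrightarrow> - a \<in> ratfuns n"
  by (erule ratfunsE) (simp add: ratfunsI)

lemma ratfuns_inverse [intro]: "a \<in> ratfuns n \<Longrightarrow> inverse a \<in> ratfuns n"
proof (erule ratfunsE)
  fix f g assume *: "a = Fraction_Field.Fract f g" "g \<noteq> 0"
      "mpoly_vars f \<subseteq> {1..n}" "mpoly_vars g \<subseteq> {1..n}"
  show "inverse a \<in> ratfuns n"
  proof (cases "f = 0")
    case False
    then show ?thesis
      unfolding *(1) Fraction_Field.inverse_fract using False *(3,4) by (intro ratfunsI)
  qed (simp add: * Fraction_Field.fract_collapse)
qed

lemma ratfuns_pd [intro]: "a \<in> ratfuns n \<Longrightarrow> pd i a \<in> ratfuns n"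
proof -
  assume "a \<in> ratfuns n"
  then obtain f g where *: "a = Fraction_Field.Fract f g" "g \<noteq> 0"
      "mpoly_vars f \<subseteq> {1..n}" "mpoly_vars g \<subseteq> {1..n}"
    unfolding ratfuns_def by blast
  have "mpoly_vars (mpoly_deriv i f * g + - (f * mpoly_deriv i g)) \<subseteq> {1..n}"
    using *(3,4) mpoly_vars_add[of "mpoly_deriv i f * g" "- (f * mpoly_deriv i g)"]
      mpoly_vars_mult[of "mpoly_deriv i f" g] mpoly_vars_mult[of f "mpoly_deriv i g"]
      mpoly_vars_deriv[of i f] mpoly_vars_deriv[of i g]
    unfolding mpoly_vars_minus by blast
  moreover have "mpoly_vars (g * g) \<subseteq> {1..n}"
    using *(4) mpoly_vars_mult[of g g] by blast
  ultimately show ?thesis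
    unfolding *(1) pd_Fract[OF *(2)] diff_conv_add_uminus using *(2) by (intro ratfunsI) simp_all
qed

lemma ratfuns_coord [intro]: "i \<in> {1..n} \<Longrightarrow> coord i \<in> ratfuns n"
  unfolding coord_def by (intro ratfunsI) (simp_all add: mpoly_vars_def)


section \<open>The ring of linear differential operators\<close>

text \<open>
  An operator \<open>\<Sum>\<^sub>\<mu> a\<^sub>\<mu> d\<^sup>\<mu>\<close>, coefficients on the left, is represented by the finitely supported map
  \<open>\<mu> \<mapsto> a\<^sub>\<mu>\<close>. On this type \<open>*\<close> is the commutative product of symbols, which agrees with the product
  of operators only if the left factor has order zero; the product of operators is \<open>diffop_mult\<close>
  below.
\<close>

type_synonym diffop = "(nat \<Rightarrow>\<^sub>0 nat) \<Rightarrow>\<^sub>0 ratfun"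

definition diffop_const :: "ratfun \<Rightarrow> diffop" where
  "diffop_const a = Poly_Mapping.single 0 a"

definition diffop_d :: "nat \<Rightarrow> diffop" where
  "diffop_d i = Poly_Mapping.single (unit_exp i) 1"

text \<open>
  Moving \<open>d\<^sub>i\<close> past the coefficients by \<open>d\<^sub>i a = a d\<^sub>i + \<partial>\<^sub>i a\<close>:
  \<open>d\<^sub>i (\<Sum>\<^sub>\<nu> b\<^sub>\<nu> d\<^sup>\<nu>) = \<Sum>\<^sub>\<nu> b\<^sub>\<nu> d\<^sub>i d\<^sup>\<nu> + \<Sum>\<^sub>\<nu> (\<partial>\<^sub>i b\<^sub>\<nu>) d\<^sup>\<nu>\<close>.
\<close>

definition d_mult :: "nat \<Rightarrow> diffop \<Rightarrow> diffop" where
  "d_mult i Q = diffop_d i * Q + Poly_Mapping.map (pd i) Q"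

definition d_power_mult :: "(nat \<Rightarrow>\<^sub>0 nat) \<Rightarrow> diffop \<Rightarrow> diffop" where
  "d_power_mult \<mu> Q =
     foldr (\<lambda>i. d_mult i ^^ Poly_Mapping.lookup \<mu> i) (sorted_list_of_set (Poly_Mapping.keys \<mu>)) Q"

definition diffop_mult :: "diffop \<Rightarrow> diffop \<Rightarrow> diffop" where
  "diffop_mult P Q =
     (\<Sum>\<mu>\<in>Poly_Mapping.keys P. diffop_const (Poly_Mapping.lookup P \<mu>) * d_power_mult \<mu> Q)"

definition diffop_ring :: "nat \<Rightarrow> diffop ring" where
  "diffop_ring n =
    \<lparr>carrier = {P. \<forall>\<mu>\<in>Poly_Mapping.keys P.
        Poly_Mapping.keys \<mu> \<subseteq> {1..n} \<and> Poly_Mapping.lookup P \<mu> \<in> ratfuns n},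
     monoid.mult = diffop_mult, one = diffop_const 1, ring.zero = 0, add = (+)\<rparr>"

lemma lookup_map_pd: "Poly_Mapping.lookup (Poly_Mapping.map (pd i) Q) \<mu> = pd i (Poly_Mapping.lookup Q \<mu>)"
  by (simp add: Poly_Mapping.map.rep_eq when_def)

lemma map_pd_add: "Poly_Mapping.map (pd i) (P + Q) = Poly_Mapping.map (pd i) P + Poly_Mapping.map (pd i) Q"
  by (rule poly_mapping_eqI) (simp add: lookup_map_pd lookup_add pd_add)

lemma map_pd_single: "Poly_Mapping.map (pd i) (Poly_Mapping.single \<mu> a) = Poly_Mapping.single \<mu> (pd i a)"
  by (rule poly_mapping_eqI) (simp add: lookup_map_pd lookup_single when_def)

lemma map_pd_0 [simp]: "Poly_Mapping.map (pd i) 0 = 0"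
  by (rule poly_mapping_eqI) (simp add: lookup_map_pd)

lemma map_pd_mult:
  "Poly_Mapping.map (pd i) (P * Q) = Poly_Mapping.map (pd i) P * Q + P * Poly_Mapping.map (pd i) Q"
proof (induction P rule: poly_mapping_single_induct)
  case (single m a)
  show ?case
    by (induction Q rule: poly_mapping_single_induct)
      (simp_all add: map_pd_add algebra_simps mult_single map_pd_single pd_mult single_add)
qed (simp_all add: map_pd_add algebra_simps)

lemma map_pd_diffop_d: "Poly_Mapping.map (pd i) (diffop_d j) = 0"
  by (simp add: diffop_d_def map_pd_single)

lemma map_pd_const: "Poly_Mapping.map (pd i) (diffop_const a) = diffop_const (pd i a)"
  by (simp add: diffop_const_def map_pd_single)

lemma d_mult_add: "d_mult i (P + Q) = d_mult i P + d_mult i Q"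
  by (simp add: d_mult_def map_pd_add algebra_simps)

lemma d_mult_0 [simp]: "d_mult i 0 = 0"
  by (simp add: d_mult_def)

lemma d_mult_const: "d_mult i (diffop_const c * Q) = diffop_const c * d_mult i Q + diffop_const (pd i c) * Q"
  by (simp add: d_mult_def map_pd_mult map_pd_const algebra_simps)

lemma d_mult_single:
  "d_mult i (Poly_Mapping.single \<nu> b) = Poly_Mapping.single (\<nu> + unit_exp i) b + Poly_Mapping.single \<nu> (pd i b)"
  by (simp add: d_mult_def diffop_d_def map_pd_single mult_single add.commute)

lemma d_mult_commute: "d_mult i (d_mult j Q) = d_mult j (d_mult i Q)"
proof -
  have "Poly_Mapping.map (pd i) (Poly_Mapping.map (pd j) Q) = Poly_Mapping.map (pd j) (Poly_Mapping.map (pd i) Q)"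
    by (rule poly_mapping_eqI) (simp add: lookup_map_pd pd_commute)
  then show ?thesis
    by (simp add: d_mult_def map_pd_add map_pd_mult map_pd_diffop_d algebra_simps)
qed

lemma comp_fun_commute_d_mult: "comp_fun_commute (\<lambda>i. d_mult i ^^ e i)"
proof
  have *: "(d_mult i ^^ a) (d_mult j Q) = d_mult j ((d_mult i ^^ a) Q)" for i j a Q
    by (induction a) (simp_all add: d_mult_commute)
  have "(d_mult i ^^ a) ((d_mult j ^^ b) Q) = (d_mult j ^^ b) ((d_mult i ^^ a) Q)" for i j a b Q
    by (induction b) (simp_all add: *)
  then show "d_mult j ^^ e j \<circ> d_mult i ^^ e i = d_mult i ^^ e i \<circ> d_mult j ^^ e j" for i j
    by (simp add: fun_eq_iff)
qed

lemma d_power_mult_eq_fold: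
  assumes "finite S" "Poly_Mapping.keys \<mu> \<subseteq> S"
  shows "d_power_mult \<mu> Q = Finite_Set.fold (\<lambda>i. d_mult i ^^ Poly_Mapping.lookup \<mu> i) Q S"
proof -
  interpret comp_fun_commute "\<lambda>i. d_mult i ^^ Poly_Mapping.lookup \<mu> i"
    by (rule comp_fun_commute_d_mult)
  have foldr: "foldr (\<lambda>i. d_mult i ^^ Poly_Mapping.lookup \<mu> i) xs Q
      = Finite_Set.fold (\<lambda>i. d_mult i ^^ Poly_Mapping.lookup \<mu> i) Q (set xs)" if "distinct xs" for xs
    using that by (induction xs) (simp_all add: fold_insert)
  have ext: "Finite_Set.fold (\<lambda>i. d_mult i ^^ Poly_Mapping.lookup \<mu> i) Q (A \<union> Poly_Mapping.keys \<mu>)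
      = Finite_Set.fold (\<lambda>i. d_mult i ^^ Poly_Mapping.lookup \<mu> i) Q (Poly_Mapping.keys \<mu>)"
    if "finite A" "A \<inter> Poly_Mapping.keys \<mu> = {}" for A
    using that
  proof (induction A)
    case (insert x A)
    then show ?case
      by (simp add: fold_insert) (simp add: in_keys_iff)
  qed simp
  have S: "(S - Poly_Mapping.keys \<mu>) \<union> Poly_Mapping.keys \<mu> = S"
    using assms by blast
  have "Finite_Set.fold (\<lambda>i. d_mult i ^^ Poly_Mapping.lookup \<mu> i) Q S
      = Finite_Set.fold (\<lambda>i. d_mult i ^^ Poly_Mapping.lookup \<mu> i) Q (Poly_Mapping.keys \<mu>)"
    using ext[of "S - Poly_Mapping.keys \<mu>"] assms(1) unfolding S by blast
  then show ?thesis
    by (simp add: d_power_mult_def foldr)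
qed

lemma d_power_mult_0 [simp]: "d_power_mult 0 Q = Q"
  by (simp add: d_power_mult_def)

lemma d_power_mult_Suc: "d_power_mult (\<mu> + unit_exp i) Q = d_mult i (d_power_mult \<mu> Q)"
proof -
  let ?T = "Poly_Mapping.keys \<mu> - {i}"
  have *: "d_power_mult \<nu> Q = (d_mult i ^^ Poly_Mapping.lookup \<nu> i)
      (Finite_Set.fold (\<lambda>i. d_mult i ^^ Poly_Mapping.lookup \<nu> i) Q ?T)"
    if "Poly_Mapping.keys \<nu> \<subseteq> insert i ?T" for \<nu>
  proof -
    interpret comp_fun_commute "\<lambda>i. d_mult i ^^ Poly_Mapping.lookup \<nu> i"
      by (rule comp_fun_commute_d_mult)
    show ?thesis
      using d_power_mult_eq_fold[OF _ that, of Q] by (simp add: fold_insert del: insert_Diff_single)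
  qed
  have "Finite_Set.fold (\<lambda>k. d_mult k ^^ Poly_Mapping.lookup (\<mu> + unit_exp i) k) Q ?T
      = Finite_Set.fold (\<lambda>k. d_mult k ^^ Poly_Mapping.lookup \<mu> k) Q ?T"
    by (rule Finite_Set.fold_cong[of UNIV])
      (use comp_fun_commute_d_mult in \<open>auto simp: comp_fun_commute_def' lookup_add lookup_single when_def\<close>)
  moreover have "Poly_Mapping.keys (\<mu> + unit_exp i) \<subseteq> insert i ?T"
    using Poly_Mapping.keys_add[of \<mu> "unit_exp i"] by (auto split: if_splits)
  ultimately show ?thesis
    by (simp add: * lookup_add del: insert_Diff_single) (subst *, auto)
qed

lemma multi_index_induct [case_names zero add]:
  assumes "P 0" "\<And>\<mu> i. P \<mu> \<Longrightarrow> P (\<mu> + unit_exp i)"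
  shows "P (\<mu> :: nat \<Rightarrow>\<^sub>0 nat)"
proof -
  have single: "P (\<mu> + Poly_Mapping.single i k)" if "P \<mu>" for \<mu> i k
  proof (induction k)
    case (Suc k)
    have "\<mu> + Poly_Mapping.single i (Suc k) = (\<mu> + Poly_Mapping.single i k) + unit_exp i"
      by (simp add: add.assoc flip: single_add)
    then show ?case using assms(2)[OF Suc] by simp
  qed (simp add: that)
  have "\<forall>\<nu>. P \<nu> \<longrightarrow> P (\<nu> + \<mu>)"
    by (induction \<mu> rule: poly_mapping_single_induct) (auto simp: single simp flip: add.assoc)
  then show ?thesis using assms(1) by fastforce
qed

lemma d_power_mult_add: "d_power_mult \<mu> (P + Q) = d_power_mult \<mu> P + d_power_mult \<mu> Q"
  by (induction \<mu> rule: multi_index_induct) (simp_all add: d_power_mult_Suc d_mult_add del: One_nat_def)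

lemma diffop_const_0 [simp]: "diffop_const 0 = 0"
  by (simp add: diffop_const_def)

lemma diffop_const_add: "diffop_const (a + b) = diffop_const a + diffop_const b"
  by (simp add: diffop_const_def single_add)

lemma diffop_const_mult: "diffop_const (a * b) = diffop_const a * diffop_const b"
  by (simp add: diffop_const_def mult_single)

lemma diffop_const_1 [simp]: "diffop_const 1 = 1"
  by (simp add: diffop_const_def)

lemma diffop_mult_superset:
  assumes "finite S" "Poly_Mapping.keys P \<subseteq> S"
  shows "diffop_mult P Q = (\<Sum>\<mu>\<in>S. diffop_const (Poly_Mapping.lookup P \<mu>) * d_power_mult \<mu> Q)"
  unfolding diffop_mult_def
  by (rule sum.mono_neutral_left) (use assms in \<open>auto simp: in_keys_iff\<close>)

lemma diffop_mult_add_left: "diffop_mult (P + P') Q = diffop_mult P Q + diffop_mult P' Q"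
proof -
  let ?S = "Poly_Mapping.keys P \<union> Poly_Mapping.keys P'"
  show ?thesis
    using Poly_Mapping.keys_add[of P P']
    by (simp add: diffop_mult_superset[of ?S] lookup_add diffop_const_add ring_distribs sum.distrib)
qed

lemma diffop_mult_add_right: "diffop_mult P (Q + Q') = diffop_mult P Q + diffop_mult P Q'"
  by (simp add: diffop_mult_def d_power_mult_add ring_distribs sum.distrib)

lemma diffop_mult_0_left [simp]: "diffop_mult 0 Q = 0"
  by (simp add: diffop_mult_def)

lemma diffop_mult_single: "diffop_mult (Poly_Mapping.single \<mu> c) Q = diffop_const c * d_power_mult \<mu> Q"
  by (cases "c = 0") (simp_all add: diffop_mult_def)

lemma diffop_mult_const [simp]: "diffop_mult (diffop_const a) Q = diffop_const a * Q"
  by (simp add: diffop_const_def[of a] diffop_mult_single)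

lemma diffop_mult_d: "diffop_mult (diffop_d i) Q = d_mult i Q"
  using d_power_mult_Suc[of 0 i Q] by (simp add: diffop_d_def diffop_mult_single)

lemma diffop_mult_const_left:
  "diffop_mult (diffop_const c * Q) R = diffop_const c * diffop_mult Q R"
proof (induction Q rule: poly_mapping_single_induct)
  case (single \<mu> a)
  have "diffop_const c * Poly_Mapping.single \<mu> a = Poly_Mapping.single \<mu> (c * a)"
    by (simp add: diffop_const_def mult_single)
  then show ?case by (simp add: diffop_mult_single diffop_const_mult mult.assoc)
qed (simp_all add: diffop_mult_add_left algebra_simps)

lemma diffop_mult_d_mult: "diffop_mult (d_mult i Q) R = d_mult i (diffop_mult Q R)"
  by (induction Q rule: poly_mapping_single_induct)
    (simp_all add: diffop_mult_add_left d_mult_add d_mult_single diffop_mult_single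
      d_power_mult_Suc d_mult_const del: One_nat_def)

lemma diffop_mult_d_power_mult:
  "diffop_mult (d_power_mult \<mu> Q) R = d_power_mult \<mu> (diffop_mult Q R)"
  by (induction \<mu> rule: multi_index_induct)
    (simp_all add: d_power_mult_Suc diffop_mult_d_mult del: One_nat_def)

lemma diffop_mult_assoc: "diffop_mult (diffop_mult P Q) R = diffop_mult P (diffop_mult Q R)"
  by (induction P rule: poly_mapping_single_induct)
    (simp_all add: diffop_mult_add_left diffop_mult_single diffop_mult_const_left
      diffop_mult_d_power_mult)

lemma d_power_mult_one: "d_power_mult \<mu> 1 = Poly_Mapping.single \<mu> 1"
  by (induction \<mu> rule: multi_index_induct)
    (simp_all add: d_power_mult_Suc d_mult_single del: One_nat_def)

lemma diffop_mult_1_left: "diffop_mult 1 Q = Q"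
  using diffop_mult_const[of 1 Q] by simp

lemma diffop_mult_1_right: "diffop_mult P 1 = P"
  by (induction P rule: poly_mapping_single_induct)
    (simp_all add: diffop_mult_add_left diffop_mult_single d_power_mult_one diffop_const_def
      mult_single)

lemma diffop_carrierD:
  assumes "P \<in> carrier (diffop_ring n)"
  shows "Poly_Mapping.lookup P \<mu> \<in> ratfuns n"
    and "Poly_Mapping.lookup P \<mu> \<noteq> 0 \<Longrightarrow> Poly_Mapping.keys \<mu> \<subseteq> {1..n}"
  using assms by (cases "Poly_Mapping.lookup P \<mu> = 0"; auto simp: diffop_ring_def in_keys_iff)+

lemma diffop_carrierI:
  assumes "\<And>\<mu>. Poly_Mapping.lookup P \<mu> \<in> ratfuns n"
    and "\<And>\<mu>. Poly_Mapping.lookup P \<mu> \<noteq> 0 \<Longrightarrow> Poly_Mapping.keys \<mu> \<subseteq> {1..n}"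
  shows "P \<in> carrier (diffop_ring n)"
  using assms by (auto simp: diffop_ring_def in_keys_iff)

lemma diffop_carrier_0 [simp]: "0 \<in> carrier (diffop_ring n)"
  by (auto intro!: diffop_carrierI)

lemma diffop_carrier_add:
  assumes "P \<in> carrier (diffop_ring n)" "Q \<in> carrier (diffop_ring n)"
  shows "P + Q \<in> carrier (diffop_ring n)"
proof (rule diffop_carrierI)
  fix \<mu> assume "Poly_Mapping.lookup (P + Q) \<mu> \<noteq> 0"
  then have "Poly_Mapping.lookup P \<mu> \<noteq> 0 \<or> Poly_Mapping.lookup Q \<mu> \<noteq> 0"
    by (auto simp: lookup_add)
  then show "Poly_Mapping.keys \<mu> \<subseteq> {1..n}"
    using diffop_carrierD[OF assms(1)] diffop_carrierD[OF assms(2)] by blast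
qed (use diffop_carrierD(1)[OF assms(1)] diffop_carrierD(1)[OF assms(2)] in \<open>auto simp: lookup_add\<close>)

lemma diffop_carrier_uminus:
  "P \<in> carrier (diffop_ring n) \<Longrightarrow> - P \<in> carrier (diffop_ring n)"
  using diffop_carrierD[of P n] by (intro diffop_carrierI) auto

lemma diffop_carrier_single:
  "c \<in> ratfuns n \<Longrightarrow> Poly_Mapping.keys \<mu> \<subseteq> {1..n} \<Longrightarrow> Poly_Mapping.single \<mu> c \<in> carrier (diffop_ring n)"
  by (auto intro!: diffop_carrierI simp: lookup_single when_def split: if_splits)

lemma diffop_carrier_const: "c \<in> ratfuns n \<Longrightarrow> diffop_const c \<in> carrier (diffop_ring n)"
  by (simp add: diffop_const_def diffop_carrier_single)

lemma diffop_carrier_d: "i \<in> {1..n} \<Longrightarrow> diffop_d i \<in> carrier (diffop_ring n)"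
  by (simp add: diffop_d_def diffop_carrier_single)

lemma diffop_carrier_sum:
  "(\<And>x. x \<in> S \<Longrightarrow> f x \<in> carrier (diffop_ring n)) \<Longrightarrow> sum f S \<in> carrier (diffop_ring n)"
  by (induction S rule: infinite_finite_induct) (auto intro: diffop_carrier_add)

lemma diffop_carrier_symbol_mult:
  assumes "P \<in> carrier (diffop_ring n)" "Q \<in> carrier (diffop_ring n)"
  shows "P * Q \<in> carrier (diffop_ring n)"
proof -
  have expand: "R = (\<Sum>\<mu>\<in>Poly_Mapping.keys R. Poly_Mapping.single \<mu> (Poly_Mapping.lookup R \<mu>))"
    for R :: diffop
    by (rule poly_mapping_eqI) (auto simp: lookup_sum lookup_single when_def in_keys_iff)
  have "P * Q = (\<Sum>\<mu>\<in>Poly_Mapping.keys P. \<Sum>\<nu>\<in>Poly_Mapping.keys Q.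
      Poly_Mapping.single (\<mu> + \<nu>) (Poly_Mapping.lookup P \<mu> * Poly_Mapping.lookup Q \<nu>))"
    by (subst expand[of P], subst expand[of Q]) (simp add: sum_product mult_single)
  also have "\<dots> \<in> carrier (diffop_ring n)"
  proof (intro diffop_carrier_sum diffop_carrier_single)
    fix \<mu> \<nu> assume "\<mu> \<in> Poly_Mapping.keys P" "\<nu> \<in> Poly_Mapping.keys Q"
    then have "Poly_Mapping.keys \<mu> \<subseteq> {1..n}" "Poly_Mapping.keys \<nu> \<subseteq> {1..n}"
      using diffop_carrierD[OF assms(1)] diffop_carrierD[OF assms(2)] by (auto simp: in_keys_iff)
    then show "Poly_Mapping.keys (\<mu> + \<nu>) \<subseteq> {1..n}"
      using Poly_Mapping.keys_add[of \<mu> \<nu>] by blast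
    show "Poly_Mapping.lookup P \<mu> * Poly_Mapping.lookup Q \<nu> \<in> ratfuns n"
      using diffop_carrierD(1)[OF assms(1)] diffop_carrierD(1)[OF assms(2)] by blast
  qed
  finally show ?thesis .
qed

lemma diffop_carrier_d_mult:
  assumes "i \<in> {1..n}" "Q \<in> carrier (diffop_ring n)"
  shows "d_mult i Q \<in> carrier (diffop_ring n)"
  unfolding d_mult_def
proof (intro diffop_carrier_add diffop_carrier_symbol_mult diffop_carrier_d assms)
  show "Poly_Mapping.map (pd i) Q \<in> carrier (diffop_ring n)"
  proof (rule diffop_carrierI)
    fix \<mu> assume "Poly_Mapping.lookup (Poly_Mapping.map (pd i) Q) \<mu> \<noteq> 0"
    then have "Poly_Mapping.lookup Q \<mu> \<noteq> 0"
      by (auto simp: lookup_map_pd)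
    then show "Poly_Mapping.keys \<mu> \<subseteq> {1..n}"
      by (rule diffop_carrierD(2)[OF assms(2)])
  qed (auto simp: lookup_map_pd intro: diffop_carrierD(1)[OF assms(2)])
qed

lemma diffop_carrier_d_power_mult:
  assumes "Poly_Mapping.keys \<mu> \<subseteq> {1..n}" "Q \<in> carrier (diffop_ring n)"
  shows "d_power_mult \<mu> Q \<in> carrier (diffop_ring n)"
proof -
  have pow: "(d_mult i ^^ k) R \<in> carrier (diffop_ring n)"
    if "i \<in> {1..n}" "R \<in> carrier (diffop_ring n)" for i k R
    using that by (induction k) (auto intro!: diffop_carrier_d_mult)
  have "foldr (\<lambda>i. d_mult i ^^ Poly_Mapping.lookup \<mu> i) xs Q \<in> carrier (diffop_ring n)"
    if "set xs \<subseteq> {1..n}" for xs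
    using that assms(2) by (induction xs) (auto intro!: pow)
  then show ?thesis using assms(1) by (simp add: d_power_mult_def)
qed

lemma diffop_carrier_mult:
  assumes "P \<in> carrier (diffop_ring n)" "Q \<in> carrier (diffop_ring n)"
  shows "diffop_mult P Q \<in> carrier (diffop_ring n)"
  unfolding diffop_mult_def
  using diffop_carrierD[OF assms(1)] assms(2)
  by (intro diffop_carrier_sum diffop_carrier_symbol_mult diffop_carrier_const
      diffop_carrier_d_power_mult) (auto simp: in_keys_iff)

lemma diffop_ring_simps [simp]:
  "P \<oplus>\<^bsub>diffop_ring n\<^esub> Q = P + Q"
  "P \<otimes>\<^bsub>diffop_ring n\<^esub> Q = diffop_mult P Q"
  "\<zero>\<^bsub>diffop_ring n\<^esub> = 0"
  "\<one>\<^bsub>diffop_ring n\<^esub> = 1"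
  by (simp_all add: diffop_ring_def)

theorem ring_diffop_ring: "ring (diffop_ring n)"
proof (rule ringI)
  show "abelian_group (diffop_ring n)"
  proof (rule abelian_groupI)
    fix P assume "P \<in> carrier (diffop_ring n)"
    then show "\<exists>Q\<in>carrier (diffop_ring n). Q \<oplus>\<^bsub>diffop_ring n\<^esub> P = \<zero>\<^bsub>diffop_ring n\<^esub>"
      using diffop_carrier_uminus by (intro bexI[of _ "- P"]) auto
  qed (auto simp: add.assoc add.commute intro: diffop_carrier_add)
  show "Group.monoid (diffop_ring n)"
    using diffop_carrier_const[of 1 n]
    by (intro monoidI) (auto simp: diffop_mult_assoc diffop_mult_1_left diffop_mult_1_right
        intro: diffop_carrier_mult)
qed (auto simp: diffop_mult_add_left diffop_mult_add_right)

text \<open>The defining relations of the ring of operators.\<close>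

lemma diffop_d_commute:
  "diffop_d i \<otimes>\<^bsub>diffop_ring n\<^esub> diffop_d j = diffop_d j \<otimes>\<^bsub>diffop_ring n\<^esub> diffop_d i"
  by (simp add: diffop_mult_d d_mult_def map_pd_diffop_d mult.commute)

lemma diffop_d_const:
  "diffop_d i \<otimes>\<^bsub>diffop_ring n\<^esub> diffop_const a =
     diffop_const a \<otimes>\<^bsub>diffop_ring n\<^esub> diffop_d i \<oplus>\<^bsub>diffop_ring n\<^esub> diffop_const (pd i a)"
  by (simp add: diffop_mult_d d_mult_def map_pd_const mult.commute)


section \<open>Left modules over a noncommutative ring\<close>

text \<open>The library's locale \<^locale>\<open>module\<close> requires a commutative ring of scalars.\<close>

locale left_module = R?: ring R + M?: abelian_group M
  for R :: "('a, 'm) ring_scheme" (structure) and M :: "('a, 'b) module" (structure) +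
  assumes lsmult_closed [simp, intro]:
      "\<lbrakk>a \<in> carrier R; x \<in> carrier M\<rbrakk> \<Longrightarrow> a \<odot>\<^bsub>M\<^esub> x \<in> carrier M"
    and lsmult_l_distr:
      "\<lbrakk>a \<in> carrier R; b \<in> carrier R; x \<in> carrier M\<rbrakk> \<Longrightarrow>
        (a \<oplus> b) \<odot>\<^bsub>M\<^esub> x = a \<odot>\<^bsub>M\<^esub> x \<oplus>\<^bsub>M\<^esub> b \<odot>\<^bsub>M\<^esub> x"
    and lsmult_r_distr:
      "\<lbrakk>a \<in> carrier R; x \<in> carrier M; y \<in> carrier M\<rbrakk> \<Longrightarrow>
        a \<odot>\<^bsub>M\<^esub> (x \<oplus>\<^bsub>M\<^esub> y) = a \<odot>\<^bsub>M\<^esub> x \<oplus>\<^bsub>M\<^esub> a \<odot>\<^bsub>M\<^esub> y"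
    and lsmult_assoc:
      "\<lbrakk>a \<in> carrier R; b \<in> carrier R; x \<in> carrier M\<rbrakk> \<Longrightarrow>
        (a \<otimes> b) \<odot>\<^bsub>M\<^esub> x = a \<odot>\<^bsub>M\<^esub> (b \<odot>\<^bsub>M\<^esub> x)"
    and lsmult_one [simp]:
      "x \<in> carrier M \<Longrightarrow> \<one> \<odot>\<^bsub>M\<^esub> x = x"

text \<open>
  Module records inherit the ring fields \<open>mult\<close> and \<open>one\<close>, which play no role for a module and are
  left \<open>undefined\<close> below.
\<close>

definition regular_module :: "('a, 'm) ring_scheme \<Rightarrow> ('a, 'a) module" where
  "regular_module R =
    \<lparr>carrier = carrier R, monoid.mult = undefined, one = undefined,
     ring.zero = \<zero>\<^bsub>R\<^esub>, add = (\<lambda>x y. x \<oplus>\<^bsub>R\<^esub> y), smult = (\<lambda>a x. a \<otimes>\<^bsub>R\<^esub> x)\<rparr>"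

definition power_module :: "('a, 'm) ring_scheme \<Rightarrow> 'i set \<Rightarrow> ('a, 'i \<Rightarrow> 'a) module" where
  "power_module R I =
    \<lparr>carrier = I \<rightarrow>\<^sub>E carrier R, monoid.mult = undefined, one = undefined,
     ring.zero = (\<lambda>i\<in>I. \<zero>\<^bsub>R\<^esub>), add = (\<lambda>x y. \<lambda>i\<in>I. x i \<oplus>\<^bsub>R\<^esub> y i),
     smult = (\<lambda>a x. \<lambda>i\<in>I. a \<otimes>\<^bsub>R\<^esub> x i)\<rparr>"

definition generated_submodule ::
    "('a, 'm) ring_scheme \<Rightarrow> ('a, 'b) module \<Rightarrow> 'b set \<Rightarrow> 'b set" where
  "generated_submodule R M S = \<Inter>{H. submodule H R M \<and> S \<subseteq> H}"

definition quotient_module :: "('a, 'b) module \<Rightarrow> 'b set \<Rightarrow> ('a, 'b set) module" where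
  "quotient_module M H =
    \<lparr>carrier = a_rcosets\<^bsub>M\<^esub> H, monoid.mult = undefined, one = undefined,
     ring.zero = H, add = set_add M,
     smult = (\<lambda>a C. \<Union>x\<in>C. H +>\<^bsub>M\<^esub> (a \<odot>\<^bsub>M\<^esub> x))\<rparr>"

definition left_module_hom ::
    "('a, 'm) ring_scheme \<Rightarrow> ('a, 'b) module \<Rightarrow> ('a, 'c) module \<Rightarrow> ('b \<Rightarrow> 'c) set" where
  "left_module_hom R M N =
    {f \<in> carrier M \<rightarrow>\<^sub>E carrier N.
      (\<forall>x\<in>carrier M. \<forall>y\<in>carrier M. f (x \<oplus>\<^bsub>M\<^esub> y) = f x \<oplus>\<^bsub>N\<^esub> f y) \<and>
      (\<forall>a\<in>carrier R. \<forall>x\<in>carrier M. f (a \<odot>\<^bsub>M\<^esub> x) = a \<odot>\<^bsub>N\<^esub> f x)}"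

definition is_module_basis :: "('a, 'm) ring_scheme \<Rightarrow> ('a, 'b) module \<Rightarrow> 'b set \<Rightarrow> bool" where
  "is_module_basis R M B \<longleftrightarrow> B \<subseteq> carrier M \<and>
    (\<forall>x\<in>carrier M. \<exists>!c. c \<in> B \<rightarrow>\<^sub>E carrier R \<and> finite {b \<in> B. c b \<noteq> \<zero>\<^bsub>R\<^esub>} \<and>
      x = (\<Oplus>\<^bsub>M\<^esub>b\<in>{b \<in> B. c b \<noteq> \<zero>\<^bsub>R\<^esub>}. c b \<odot>\<^bsub>M\<^esub> b))"

definition is_free_module :: "('a, 'm) ring_scheme \<Rightarrow> ('a, 'b) module \<Rightarrow> bool" where
  "is_free_module R M \<longleftrightarrow> left_module R M \<and> (\<exists>B. is_module_basis R M B)"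


lemma left_module_regular:
  assumes "ring R"
  shows "left_module R (regular_module R)"
proof -
  interpret ring R by fact
  show ?thesis
  proof (intro left_module.intro left_module_axioms.intro assms)
    show "abelian_group (regular_module R)"
      by (rule abelian_groupI)
        (auto simp: regular_module_def a_assoc intro: a_comm l_neg a_inv_closed)
  qed (auto simp: regular_module_def l_distr r_distr m_assoc)
qed

lemma left_module_power:
  fixes I :: "'i set"
  assumes "ring (R :: ('a, 'm) ring_scheme)"
  shows "left_module R (power_module R I)"
proof -
  interpret ring R by fact
  have ext: "(\<lambda>i\<in>I. x i) = y \<longleftrightarrow> y \<in> extensional I \<and> (\<forall>i\<in>I. x i = y i)" for x y :: "'i \<Rightarrow> 'a"
    by (auto simp: restrict_def extensional_def fun_eq_iff)
  show ?thesis
  proof (intro left_module.intro left_module_axioms.intro assms)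
    show "abelian_group (power_module R I)"
    proof (rule abelian_groupI)
      fix x assume "x \<in> carrier (power_module R I)"
      then show "\<exists>y\<in>carrier (power_module R I).
          y \<oplus>\<^bsub>power_module R I\<^esub> x = \<zero>\<^bsub>power_module R I\<^esub>"
        by (intro bexI[of _ "\<lambda>i\<in>I. \<ominus>\<^bsub>R\<^esub> x i"])
          (auto simp: power_module_def l_neg PiE_iff intro!: restrict_ext)
    qed (auto simp: power_module_def ext PiE_iff a_assoc intro!: restrict_ext intro: a_comm)
  qed (auto simp: power_module_def ext PiE_iff l_distr r_distr m_assoc intro!: restrict_ext)
qed

lemma submodule_generated_submodule:
  assumes "left_module R M" "S \<subseteq> carrier M"
  shows "submodule (generated_submodule R M S) R M"
proof -
  interpret left_module R M by fact
  have "submodule (carrier M) R M"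
    using group.subgroup_self[OF M.a_group] by (intro submodule.intro submodule_axioms.intro) auto
  then have ne: "{H. submodule H R M \<and> S \<subseteq> H} \<noteq> {}"
    using assms(2) by blast
  show ?thesis
    unfolding generated_submodule_def
  proof (intro submodule.intro submodule_axioms.intro)
    show "subgroup (\<Inter>{H. submodule H R M \<and> S \<subseteq> H}) (add_monoid M)"
      using ne by (intro group.subgroups_Inter[OF M.a_group]) (auto dest: submodule.axioms(1))
  qed (auto intro: submodule.smult_closed)
qed

lemma left_module_quotient:
  assumes "left_module R M" "submodule H R M"
  shows "left_module R (quotient_module M H)"
proof -
  interpret left_module R M by fact
  interpret H: submodule H R M by fact
  interpret abelian_subgroup H M
    using H.subgroup_axioms by (intro abelian_subgroupI3 additive_subgroupI) (auto intro: M.abelian_group_axioms)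
  let ?Q = "quotient_module M H"
  have comm: "comm_group (M A_Mod H)"
    by (rule a_factorgroup_is_comm_group)
  have Q: "carrier ?Q = carrier (M A_Mod H)" "add ?Q = monoid.mult (M A_Mod H)"
      "\<zero>\<^bsub>?Q\<^esub> = \<one>\<^bsub>M A_Mod H\<^esub>"
    by (simp_all add: quotient_module_def A_FactGroup_def A_RCOSETS_def set_add_def FactGroup_def)
  have ab: "abelian_group ?Q"
  proof -
    interpret C: comm_group "M A_Mod H" by (rule comm)
    show ?thesis
    proof (rule abelian_groupI)
      fix x assume "x \<in> carrier ?Q"
      then show "\<exists>y\<in>carrier ?Q. y \<oplus>\<^bsub>?Q\<^esub> x = \<zero>\<^bsub>?Q\<^esub>"
        unfolding Q using C.l_inv_ex by blast
    qed (unfold Q, simp_all only: C.m_closed C.m_assoc C.one_closed C.l_one, rule C.m_comm)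
  qed
  have smult: "a \<odot>\<^bsub>?Q\<^esub> (H +>\<^bsub>M\<^esub> x) = H +>\<^bsub>M\<^esub> (a \<odot>\<^bsub>M\<^esub> x)"
    if "a \<in> carrier R" "x \<in> carrier M" for a x
  proof -
    have "H +>\<^bsub>M\<^esub> (a \<odot>\<^bsub>M\<^esub> y) = H +>\<^bsub>M\<^esub> (a \<odot>\<^bsub>M\<^esub> x)" if y: "y \<in> H +>\<^bsub>M\<^esub> x" for y
    proof -
      obtain h where h: "h \<in> H" "y = h \<oplus>\<^bsub>M\<^esub> x"
        using y by (auto simp: a_r_coset_def')
      have hc: "h \<in> carrier M" using h(1) a_subset by blast
      have "a \<odot>\<^bsub>M\<^esub> y = a \<odot>\<^bsub>M\<^esub> h \<oplus>\<^bsub>M\<^esub> a \<odot>\<^bsub>M\<^esub> x"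
        using h hc that \<open>a \<in> carrier R\<close> \<open>x \<in> carrier M\<close> by (simp add: lsmult_r_distr)
      then have "a \<odot>\<^bsub>M\<^esub> y \<in> H +>\<^bsub>M\<^esub> (a \<odot>\<^bsub>M\<^esub> x)"
        using H.smult_closed[OF \<open>a \<in> carrier R\<close> h(1)] by (auto simp: a_r_coset_def')
      then show ?thesis
        using \<open>a \<in> carrier R\<close> \<open>x \<in> carrier M\<close> H.subgroup_axioms
        by (intro a_repr_independence[symmetric]) auto
    qed
    moreover have "x \<in> H +>\<^bsub>M\<^esub> x"
      using \<open>x \<in> carrier M\<close> by (rule a_rcos_self)
    ultimately have "(\<Union>y\<in>H +>\<^bsub>M\<^esub> x. H +>\<^bsub>M\<^esub> (a \<odot>\<^bsub>M\<^esub> y)) = H +>\<^bsub>M\<^esub> (a \<odot>\<^bsub>M\<^esub> x)"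
      by blast
    then show ?thesis
      by (simp only: quotient_module_def module.simps)
  qed
  have add: "(H +>\<^bsub>M\<^esub> x) \<oplus>\<^bsub>?Q\<^esub> (H +>\<^bsub>M\<^esub> y) = H +>\<^bsub>M\<^esub> (x \<oplus>\<^bsub>M\<^esub> y)"
    if "x \<in> carrier M" "y \<in> carrier M" for x y
    using that by (simp add: quotient_module_def a_rcos_sum)
  have carrE: "\<exists>x\<in>carrier M. C = H +>\<^bsub>M\<^esub> x" if "C \<in> carrier ?Q" for C
    using that by (auto simp: quotient_module_def A_RCOSETS_def')
  have carrI: "H +>\<^bsub>M\<^esub> x \<in> carrier ?Q" if "x \<in> carrier M" for x
    using that by (auto simp: quotient_module_def A_RCOSETS_def')
  show ?thesis
  proof (intro left_module.intro left_module_axioms.intro ab R.ring_axioms)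
  qed (auto dest!: carrE simp: smult add carrI lsmult_l_distr lsmult_r_distr lsmult_assoc)
qed

lemma is_free_module_regular:
  assumes "ring R"
  shows "is_free_module R (regular_module R)"
proof -
  interpret ring R by fact
  interpret left_module R "regular_module R"
    by (rule left_module_regular[OF assms])
  have simps: "carrier (regular_module R) = carrier R" "\<zero>\<^bsub>regular_module R\<^esub> = \<zero>\<^bsub>R\<^esub>"
      "x \<odot>\<^bsub>regular_module R\<^esub> y = x \<otimes>\<^bsub>R\<^esub> y" for x y
    by (simp_all add: regular_module_def)
  have sum: "(\<Oplus>\<^bsub>regular_module R\<^esub>b\<in>{b \<in> {\<one>\<^bsub>R\<^esub>}. c b \<noteq> \<zero>\<^bsub>R\<^esub>}. c b \<odot>\<^bsub>regular_module R\<^esub> b) = c \<one>\<^bsub>R\<^esub>"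
    if "c \<in> {\<one>\<^bsub>R\<^esub>} \<rightarrow>\<^sub>E carrier R" for c
  proof (cases "c \<one>\<^bsub>R\<^esub> = \<zero>\<^bsub>R\<^esub>")
    case True
    then have "{b \<in> {\<one>\<^bsub>R\<^esub>}. c b \<noteq> \<zero>\<^bsub>R\<^esub>} = {}" by auto
    then show ?thesis using True by (simp only: M.finsum_empty simps)
  next
    case False
    then have "{b \<in> {\<one>\<^bsub>R\<^esub>}. c b \<noteq> \<zero>\<^bsub>R\<^esub>} = {\<one>\<^bsub>R\<^esub>}" by auto
    moreover have "c \<one>\<^bsub>R\<^esub> \<in> carrier R" using that by auto
    ultimately show ?thesis
      using M.finsum_insert[of "{}" "\<one>\<^bsub>R\<^esub>" "\<lambda>b. c b \<odot>\<^bsub>regular_module R\<^esub> b"]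
      by (simp add: simps M.r_zero[unfolded simps])
  qed
  have "is_module_basis R (regular_module R) {\<one>\<^bsub>R\<^esub>}"
    unfolding is_module_basis_def
  proof (intro conjI ballI)
    fix x assume "x \<in> carrier (regular_module R)"
    then have x: "x \<in> carrier R" by (simp add: simps)
    show "\<exists>!c. c \<in> {\<one>\<^bsub>R\<^esub>} \<rightarrow>\<^sub>E carrier R \<and> finite {b \<in> {\<one>\<^bsub>R\<^esub>}. c b \<noteq> \<zero>\<^bsub>R\<^esub>} \<and>
      x = (\<Oplus>\<^bsub>regular_module R\<^esub>b\<in>{b \<in> {\<one>\<^bsub>R\<^esub>}. c b \<noteq> \<zero>\<^bsub>R\<^esub>}. c b \<odot>\<^bsub>regular_module R\<^esub> b)"
    proof (rule ex1I[of _ "\<lambda>b\<in>{\<one>\<^bsub>R\<^esub>}. x"], goal_cases)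
      case 1
      have "(\<lambda>b\<in>{\<one>\<^bsub>R\<^esub>}. x) \<in> {\<one>\<^bsub>R\<^esub>} \<rightarrow>\<^sub>E carrier R" using x by auto
      from this sum[OF this] show ?case by simp
    next
      case (2 c)
      then have "c \<in> {\<one>\<^bsub>R\<^esub>} \<rightarrow>\<^sub>E carrier R" "x = c \<one>\<^bsub>R\<^esub>" using sum[of c] by auto
      then show ?case by (intro ext) (auto simp: PiE_def extensional_def)
    qed
  qed (simp add: simps)
  then show ?thesis
    using left_module_axioms by (auto simp: is_free_module_def)
qed


section \<open>Free resolutions and Ext\<close>

text \<open>
  An exact sequence \<open>\<dots> \<rightarrow> P 2 \<rightarrow> P 1 \<rightarrow> P 0 \<rightarrow> M \<rightarrow> 0\<close> with all \<open>P i\<close> free, where \<open>\<delta> i\<close> is the map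
  \<open>P (i + 1) \<rightarrow> P i\<close> and \<open>\<epsilon>\<close> is the map \<open>P 0 \<rightarrow> M\<close>.
\<close>

definition free_resolution ::
    "('a, 'm) ring_scheme \<Rightarrow> ('a, 'b) module \<Rightarrow> (nat \<Rightarrow> ('a, 'c) module) \<Rightarrow>
     (nat \<Rightarrow> 'c \<Rightarrow> 'c) \<Rightarrow> ('c \<Rightarrow> 'b) \<Rightarrow> bool" where
  "free_resolution R M P \<delta> \<epsilon> \<longleftrightarrow>
    (\<forall>i. is_free_module R (P i)) \<and>
    \<epsilon> \<in> left_module_hom R (P 0) M \<and>
    (\<forall>i. \<delta> i \<in> left_module_hom R (P (Suc i)) (P i)) \<and>
    \<epsilon> ` carrier (P 0) = carrier M \<and>
    \<delta> 0 ` carrier (P 1) = a_kernel (P 0) M \<epsilon> \<and>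
    (\<forall>i. \<delta> (Suc i) ` carrier (P (Suc (Suc i))) = a_kernel (P (Suc i)) (P i) (\<delta> i))"

text \<open>A free module is resolved by itself.\<close>

lemma free_resolution_of_free:
  assumes "is_free_module R M"
  defines "Z \<equiv> M\<lparr>carrier := {\<zero>\<^bsub>M\<^esub>}\<rparr>"
  shows "free_resolution R M (\<lambda>i. if i = 0 then M else Z) (\<lambda>i. \<lambda>x\<in>{\<zero>\<^bsub>M\<^esub>}. \<zero>\<^bsub>M\<^esub>)
    (\<lambda>x\<in>carrier M. x)"
proof -
  interpret left_module R M using assms(1) by (simp add: is_free_module_def)
  have sm0: "a \<odot>\<^bsub>M\<^esub> \<zero>\<^bsub>M\<^esub> = \<zero>\<^bsub>M\<^esub>" if "a \<in> carrier R" for a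
  proof -
    have "a \<odot>\<^bsub>M\<^esub> \<zero>\<^bsub>M\<^esub> \<oplus>\<^bsub>M\<^esub> a \<odot>\<^bsub>M\<^esub> \<zero>\<^bsub>M\<^esub> = a \<odot>\<^bsub>M\<^esub> \<zero>\<^bsub>M\<^esub>"
      using lsmult_r_distr[OF that M.zero_closed M.zero_closed] by simp
    then show ?thesis
      using that by (metis M.add.r_cancel_one M.zero_closed lsmult_closed)
  qed
  have Z: "left_module R Z"
  proof (intro left_module.intro left_module_axioms.intro R.ring_axioms)
    show "abelian_group Z"
      by (rule abelian_groupI) (auto simp: Z_def)
  qed (auto simp: Z_def sm0)
  have "is_module_basis R Z {}"
    by (auto simp: is_module_basis_def Z_def finsum_def finprod_def)
  then have Zfree: "is_free_module R Z"
    using Z by (auto simp: is_free_module_def)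
  then show ?thesis
    using assms(1)
    by (auto simp: free_resolution_def left_module_hom_def Z_def a_kernel_def kernel_def sm0)
qed

definition hom_group ::
    "('a, 'm) ring_scheme \<Rightarrow> ('a, 'b) module \<Rightarrow> ('a, 'c) module \<Rightarrow> ('b \<Rightarrow> 'c) monoid" where
  "hom_group R M N =
    \<lparr>carrier = left_module_hom R M N,
     monoid.mult = (\<lambda>f g. \<lambda>x\<in>carrier M. f x \<oplus>\<^bsub>N\<^esub> g x),
     one = (\<lambda>x\<in>carrier M. \<zero>\<^bsub>N\<^esub>)\<rparr>"

text \<open>
  The cohomology at \<open>hom (P i, N)\<close> of
  \<open>0 \<rightarrow> hom (P 0, N) \<rightarrow> hom (P 1, N) \<rightarrow> hom (P 2, N) \<rightarrow> \<dots>\<close>, whose maps are composition with \<open>\<delta>\<close>.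
  Applied to a free resolution of \<open>M\<close> it is \<open>ext\<^sup>i(M, N)\<close>, which up to isomorphism does not depend on
  the resolution.
\<close>

definition ext_cocycles ::
    "('a, 'm) ring_scheme \<Rightarrow> (nat \<Rightarrow> ('a, 'c) module) \<Rightarrow> (nat \<Rightarrow> 'c \<Rightarrow> 'c) \<Rightarrow> ('a, 'd) module \<Rightarrow>
     nat \<Rightarrow> ('c \<Rightarrow> 'd) set" where
  "ext_cocycles R P \<delta> N i =
    kernel (hom_group R (P i) N) (hom_group R (P (Suc i)) N)
      (\<lambda>f. compose (carrier (P (Suc i))) f (\<delta> i))"

definition ext_coboundaries ::
    "('a, 'm) ring_scheme \<Rightarrow> (nat \<Rightarrow> ('a, 'c) module) \<Rightarrow> (nat \<Rightarrow> 'c \<Rightarrow> 'c) \<Rightarrow> ('a, 'd) module \<Rightarrow>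
     nat \<Rightarrow> ('c \<Rightarrow> 'd) set" where
  "ext_coboundaries R P \<delta> N i =
    (case i of
      0 \<Rightarrow> {\<one>\<^bsub>hom_group R (P 0) N\<^esub>}
    | Suc j \<Rightarrow> (\<lambda>f. compose (carrier (P (Suc j))) f (\<delta> j)) ` carrier (hom_group R (P j) N))"

definition ext_group ::
    "('a, 'm) ring_scheme \<Rightarrow> (nat \<Rightarrow> ('a, 'c) module) \<Rightarrow> (nat \<Rightarrow> 'c \<Rightarrow> 'c) \<Rightarrow> ('a, 'd) module \<Rightarrow>
     nat \<Rightarrow> ('c \<Rightarrow> 'd) set monoid" where
  "ext_group R P \<delta> N i =
    (hom_group R (P i) N)\<lparr>carrier := ext_cocycles R P \<delta> N i\<rparr> Mod ext_coboundaries R P \<delta> N i"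


section \<open>The system of infinitesimal contact transformations\<close>

text \<open>
  The row of coefficients of \<open>(\<L>(\<xi>)\<alpha>)\<^sub>i = \<alpha>\<^sub>r \<partial>\<^sub>i\<xi>\<^sup>r + \<xi>\<^sup>r \<partial>\<^sub>r\<alpha>\<^sub>i\<close> in the unknowns
  \<open>\<xi>\<^sup>1, \<dots>, \<xi>\<^sup>n\<close>, as an element of \<open>D\<^sup>n\<close>.
\<close>

definition lie_row :: "nat \<Rightarrow> (nat \<Rightarrow> ratfun) \<Rightarrow> nat \<Rightarrow> nat \<Rightarrow> diffop" where
  "lie_row n \<alpha> i = (\<lambda>r\<in>{1..n}.
     diffop_const (\<alpha> r) \<otimes>\<^bsub>diffop_ring n\<^esub> diffop_d i \<oplus>\<^bsub>diffop_ring n\<^esub> diffop_const (pd r (\<alpha> i)))"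

text \<open>The equation \<open>\<alpha>\<^sub>j (\<L>(\<xi>)\<alpha>)\<^sub>i - \<alpha>\<^sub>i (\<L>(\<xi>)\<alpha>)\<^sub>j = 0\<close>.\<close>

definition proportional_row :: "nat \<Rightarrow> (nat \<Rightarrow> ratfun) \<Rightarrow> nat \<Rightarrow> nat \<Rightarrow> nat \<Rightarrow> diffop" where
  "proportional_row n \<alpha> i j = (let F = power_module (diffop_ring n) {1..n} in
     (diffop_const (\<alpha> j) \<odot>\<^bsub>F\<^esub> lie_row n \<alpha> i) \<ominus>\<^bsub>F\<^esub> (diffop_const (\<alpha> i) \<odot>\<^bsub>F\<^esub> lie_row n \<alpha> j))"

definition conformal_module :: "nat \<Rightarrow> (nat \<Rightarrow> ratfun) \<Rightarrow> (diffop, (nat \<Rightarrow> diffop) set) module" where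
  "conformal_module n \<alpha> = (let F = power_module (diffop_ring n) {1..n} in
     quotient_module F (generated_submodule (diffop_ring n) F
       {proportional_row n \<alpha> i j | i j. i \<in> {1..n} \<and> j \<in> {1..n}}))"

text \<open>The components of \<open>dx\<^sup>n - \<Sum>\<^sub>a x\<^bsup>a+p\<^esup> dx\<^sup>a\<close>, where \<open>n = 2p + 1\<close> and \<open>a\<close> ranges over \<open>1, \<dots>, p\<close>.\<close>

definition contact_form :: "nat \<Rightarrow> nat \<Rightarrow> ratfun" where
  "contact_form p i =
    (if i = 2 * p + 1 then 1 else if i \<in> {1..p} then - coord (i + p) else 0)"

definition contact_module :: "nat \<Rightarrow> (diffop, (nat \<Rightarrow> diffop) set) module" where
  "contact_module p = conformal_module (2 * p + 1) (contact_form p)"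

lemma left_module_contact_module: "left_module (diffop_ring (2 * p + 1)) (contact_module p)"
proof -
  let ?n = "2 * p + 1"
  let ?F = "power_module (diffop_ring ?n) {1..?n}"
  have F: "left_module (diffop_ring ?n) ?F"
    by (rule left_module_power[OF ring_diffop_ring])
  interpret left_module "diffop_ring ?n" ?F by (rule F)
  have \<alpha>: "contact_form p i \<in> ratfuns ?n" for i
    unfolding contact_form_def by (auto simp del: One_nat_def intro!: ratfuns_uminus ratfuns_coord)
  have "lie_row ?n (contact_form p) i \<in> carrier ?F" if "i \<in> {1..?n}" for i
    using that \<alpha> diffop_carrier_d[OF that]
    by (auto simp: lie_row_def power_module_def simp del: diffop_mult_const
        intro!: diffop_carrier_add diffop_carrier_mult diffop_carrier_const)
  then have "proportional_row ?n (contact_form p) i j \<in> carrier ?F"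
    if "i \<in> {1..?n}" "j \<in> {1..?n}" for i j
    unfolding proportional_row_def Let_def
    using that \<alpha> by (intro M.minus_closed lsmult_closed diffop_carrier_const) auto
  then show ?thesis
    unfolding contact_module_def conformal_module_def Let_def
    by (intro left_module_quotient[OF F] submodule_generated_submodule[OF F]) auto
qed

end

theory Submission
  imports Defs
begin

text \<open>
  A contact vector field \<open>\<xi>\<close> is determined by its generating function \<open>f = \<alpha>(\<xi>)\<close>, and \<open>f\<close> is arbitrary. In
  terms of Cartan's formula \<open>\<L>(\<xi>)\<alpha> = df + \<iota>\<^sub>\<xi> d\<alpha>\<close>, proportionality of this form to \<open>\<alpha>\<close> can be solved for
  \<open>\<xi>\<close>, giving \<open>\<xi>\<^sup>r = Q\<^sub>r f\<close> with explicit first order operators \<open>Q\<^sub>r\<close>. For the differential module this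
  says that \<open>M\<close> is generated by the class \<open>m\<close> of \<open>\<alpha>(\<xi>)\<close>, and that the substitution \<open>\<xi>\<^sup>r \<mapsto> Q\<^sub>r\<close> defines a
  \<open>D\<close>-linear map \<open>g : M \<rightarrow> D\<close> with \<open>C = g(C) m\<close> for all \<open>C\<close> in \<open>M\<close> (\<open>contact_module_dual_basis\<close>). Two
  computations are behind it: substitution annihilates the contact equations
  (\<open>contact_parametrization_relation\<close>), and the equations \<open>\<xi>\<^sup>r = Q\<^sub>r \<alpha>(\<xi>)\<close> follow from them
  (\<open>residual_row_mem\<close>).

  Such a pair \<open>(g, m)\<close> makes \<open>M\<close> projective: every surjection onto \<open>M\<close> has a section
  (\<open>dual_basis_section\<close>). Hence any free resolution of \<open>M\<close> splits, step by step, into direct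
  summands; applying \<open>hom\<close> preserves the splitting, so that every cocycle of positive degree is a
  coboundary (\<open>ext_group_trivial\<close>). This works for the given resolution directly, without comparing
  resolutions.
\<close>

section \<open>Homomorphisms of left modules\<close>

lemma left_module_homI:
  assumes "f \<in> carrier M \<rightarrow>\<^sub>E carrier N"
    and "\<And>x y. x \<in> carrier M \<Longrightarrow> y \<in> carrier M \<Longrightarrow> f (x \<oplus>\<^bsub>M\<^esub> y) = f x \<oplus>\<^bsub>N\<^esub> f y"
    and "\<And>a x. a \<in> carrier R \<Longrightarrow> x \<in> carrier M \<Longrightarrow> f (a \<odot>\<^bsub>M\<^esub> x) = a \<odot>\<^bsub>N\<^esub> f x"
  shows "f \<in> left_module_hom R M N"
  using assms by (simp add: left_module_hom_def)

lemma left_module_hom_eqI: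
  assumes "f \<in> left_module_hom R M N" "g \<in> left_module_hom R M N'"
    and "\<And>x. x \<in> carrier M \<Longrightarrow> f x = g x"
  shows "f = g"
proof (rule extensionalityI)
  show "f \<in> extensional (carrier M)" "g \<in> extensional (carrier M)"
    using assms(1,2) by (simp_all add: left_module_hom_def PiE_def)
qed (rule assms(3))

lemma (in abelian_group) minus_add_cancel_right:
  "x \<in> carrier G \<Longrightarrow> y \<in> carrier G \<Longrightarrow> x \<ominus> y \<oplus> y = x"
  by (simp add: a_minus_def a_assoc l_neg)

lemma (in left_module) lsmult_zero [simp]:
  assumes "a \<in> carrier R"
  shows "a \<odot>\<^bsub>M\<^esub> \<zero>\<^bsub>M\<^esub> = \<zero>\<^bsub>M\<^esub>"
proof -
  have "a \<odot>\<^bsub>M\<^esub> \<zero>\<^bsub>M\<^esub> \<oplus>\<^bsub>M\<^esub> a \<odot>\<^bsub>M\<^esub> \<zero>\<^bsub>M\<^esub> = a \<odot>\<^bsub>M\<^esub> \<zero>\<^bsub>M\<^esub>"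
    using lsmult_r_distr[OF assms M.zero_closed M.zero_closed] by simp
  then show ?thesis
    using assms by (metis M.add.r_cancel_one M.zero_closed lsmult_closed)
qed

lemma (in left_module) lsmult_minus:
  assumes "a \<in> carrier R" "x \<in> carrier M"
  shows "a \<odot>\<^bsub>M\<^esub> (\<ominus>\<^bsub>M\<^esub> x) = \<ominus>\<^bsub>M\<^esub> (a \<odot>\<^bsub>M\<^esub> x)"
proof -
  have "a \<odot>\<^bsub>M\<^esub> (\<ominus>\<^bsub>M\<^esub> x) \<oplus>\<^bsub>M\<^esub> a \<odot>\<^bsub>M\<^esub> x = \<zero>\<^bsub>M\<^esub>"
    using assms by (simp add: M.l_neg flip: lsmult_r_distr)
  then show ?thesis
    using assms by (simp add: M.minus_equality)
qed

lemma mem_a_kernel: "x \<in> a_kernel M N f \<longleftrightarrow> x \<in> carrier M \<and> f x = \<zero>\<^bsub>N\<^esub>"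
  by (simp add: a_kernel_def kernel_def)

locale left_module_map = M?: left_module R M + N?: left_module R N
  for R :: "('a, 'm) ring_scheme" (structure)
    and M :: "('a, 'b) module" (structure) and N :: "('a, 'c) module" (structure) +
  fixes f
  assumes hom: "f \<in> left_module_hom R M N"
begin

lemma closed [simp, intro]: "x \<in> carrier M \<Longrightarrow> f x \<in> carrier N"
  using hom by (auto simp: left_module_hom_def)

lemma add: "x \<in> carrier M \<Longrightarrow> y \<in> carrier M \<Longrightarrow> f (x \<oplus>\<^bsub>M\<^esub> y) = f x \<oplus>\<^bsub>N\<^esub> f y"
  using hom by (auto simp: left_module_hom_def)

lemma smult: "a \<in> carrier R \<Longrightarrow> x \<in> carrier M \<Longrightarrow> f (a \<odot>\<^bsub>M\<^esub> x) = a \<odot>\<^bsub>N\<^esub> f x"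
  using hom by (auto simp: left_module_hom_def)

sublocale abelian_group_hom M N f
  by (intro abelian_group_homI M.M.abelian_group_axioms N.M.abelian_group_axioms group_hom.intro
      group_hom_axioms.intro M.M.a_group N.M.a_group)
    (auto simp: hom_def add)

lemma minus: "x \<in> carrier M \<Longrightarrow> y \<in> carrier M \<Longrightarrow> f (x \<ominus>\<^bsub>M\<^esub> y) = f x \<ominus>\<^bsub>N\<^esub> f y"
  by (simp add: a_minus_def)

lemma finsum:
  "finite S \<Longrightarrow> u \<in> S \<rightarrow> carrier M \<Longrightarrow> f (\<Oplus>\<^bsub>M\<^esub>b\<in>S. u b) = (\<Oplus>\<^bsub>N\<^esub>b\<in>S. f (u b))"
proof (induction S rule: finite_induct)
  case (insert s S)
  then have "u \<in> S \<rightarrow> carrier M" "u s \<in> carrier M" "(\<lambda>b. f (u b)) \<in> S \<rightarrow> carrier N"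
    by auto
  then show ?case
    using insert.hyps insert.IH by (simp add: add)
qed simp

lemma kernel_submodule: "submodule (a_kernel M N f) R M"
proof (intro submodule.intro submodule_axioms.intro)
  show "subgroup (a_kernel M N f) (add_monoid M)"
    by (rule additive_subgroup.a_subgroup[OF additive_subgroup_a_kernel])
  fix a x assume a: "a \<in> carrier R" and x: "x \<in> a_kernel M N f"
  have "x \<in> carrier M" "f x = \<zero>\<^bsub>N\<^esub>"
    using iffD1[OF mem_a_kernel x] by (rule conjunct1, rule conjunct2)
  then have "a \<odot>\<^bsub>M\<^esub> x \<in> carrier M" "f (a \<odot>\<^bsub>M\<^esub> x) = \<zero>\<^bsub>N\<^esub>"
    using a by (simp_all only: smult M.lsmult_closed N.lsmult_zero)
  then show "a \<odot>\<^bsub>M\<^esub> x \<in> a_kernel M N f"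
    by (intro iffD2[OF mem_a_kernel] conjI)
qed

end

lemma left_module_mapI:
  assumes "left_module R M" "left_module R N" "f \<in> left_module_hom R M N"
  shows "left_module_map R M N f"
  using assms by (simp add: left_module_map_def left_module_map_axioms_def)

lemma left_module_hom_compose:
  assumes "f \<in> left_module_hom R M N" "g \<in> left_module_hom R L M"
    and "left_module R L"
  shows "compose (carrier L) f g \<in> left_module_hom R L N"
proof -
  interpret L: left_module R L by fact
  show ?thesis
    using assms(1,2) by (auto simp: left_module_hom_def compose_def Pi_iff PiE_iff)
qed

lemma left_module_hom_add:
  assumes "left_module R M" "left_module R N"
    and f: "f \<in> left_module_hom R M N" and g: "g \<in> left_module_hom R M N"
  shows "(\<lambda>x\<in>carrier M. f x \<oplus>\<^bsub>N\<^esub> g x) \<in> left_module_hom R M N"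
proof -
  interpret f: left_module_map R M N f
    by (rule left_module_mapI[OF assms(1,2) f])
  interpret g: left_module_map R M N g
    by (rule left_module_mapI[OF assms(1,2) g])
  show ?thesis
    by (rule left_module_homI)
      (auto simp: f.add g.add f.smult g.smult f.N.lsmult_r_distr f.N.M.a_ac)
qed

lemma left_module_hom_uminus:
  assumes "left_module R M" "left_module R N" and f: "f \<in> left_module_hom R M N"
  shows "(\<lambda>x\<in>carrier M. \<ominus>\<^bsub>N\<^esub> f x) \<in> left_module_hom R M N"
proof -
  interpret f: left_module_map R M N f
    by (rule left_module_mapI[OF assms(1,2) f])
  show ?thesis
    by (intro left_module_homI) (auto simp: f.add f.smult f.N.M.minus_add f.N.lsmult_minus)
qed

lemma left_module_hom_zero:
  assumes "left_module R M" "left_module R N"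
  shows "(\<lambda>x\<in>carrier M. \<zero>\<^bsub>N\<^esub>) \<in> left_module_hom R M N"
proof -
  interpret M: left_module R M by fact
  interpret N: left_module R N by fact
  show ?thesis
    by (intro left_module_homI) auto
qed

section \<open>Free modules\<close>

lemma (in left_module) lsmult_l_zero [simp]:
  assumes "x \<in> carrier M"
  shows "\<zero> \<odot>\<^bsub>M\<^esub> x = \<zero>\<^bsub>M\<^esub>"
proof -
  have "\<zero> \<odot>\<^bsub>M\<^esub> x \<oplus>\<^bsub>M\<^esub> \<zero> \<odot>\<^bsub>M\<^esub> x = \<zero> \<odot>\<^bsub>M\<^esub> x"
    using lsmult_l_distr[OF R.zero_closed R.zero_closed assms] by simp
  then show ?thesis
    using assms by (metis M.add.r_cancel_one R.zero_closed lsmult_closed)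
qed

lemma (in left_module) lsmult_finsum:
  assumes "a \<in> carrier R" "finite S" "u \<in> S \<rightarrow> carrier M"
  shows "a \<odot>\<^bsub>M\<^esub> (\<Oplus>\<^bsub>M\<^esub>b\<in>S. u b) = (\<Oplus>\<^bsub>M\<^esub>b\<in>S. a \<odot>\<^bsub>M\<^esub> u b)"
  using assms(2,3)
proof (induction S rule: finite_induct)
  case (insert s S)
  then have "u \<in> S \<rightarrow> carrier M" "u s \<in> carrier M" "(\<lambda>b. a \<odot>\<^bsub>M\<^esub> u b) \<in> S \<rightarrow> carrier M"
    using assms(1) by auto
  then show ?case
    using insert.hyps insert.IH assms(1) by (simp add: lsmult_r_distr)
qed (simp add: assms(1))

lemma (in left_module) finsum_coeffs_superset:
  assumes "finite S" "T \<subseteq> S" "c \<in> S \<rightarrow> carrier R" "u \<in> S \<rightarrow> carrier M"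
    and "\<And>b. b \<in> S - T \<Longrightarrow> c b = \<zero>"
  shows "(\<Oplus>\<^bsub>M\<^esub>b\<in>T. c b \<odot>\<^bsub>M\<^esub> u b) = (\<Oplus>\<^bsub>M\<^esub>b\<in>S. c b \<odot>\<^bsub>M\<^esub> u b)"
  by (rule M.add.finprod_mono_neutral_cong_left) (use assms in \<open>auto simp: Pi_iff\<close>)

text \<open>
  The coordinates of \<open>x \<oplus> y\<close> and \<open>a \<odot> x\<close> are computed from those of \<open>x\<close> and \<open>y\<close> by uniqueness. Supports
  differ, and may shrink under addition, so sums are compared over a common finite set containing
  them.
\<close>

lemma free_module_extend:
  assumes F: "left_module R F" and B: "is_module_basis R F B"
    and N: "left_module R N" and h: "h \<in> B \<rightarrow> carrier N"
  shows "\<exists>g\<in>left_module_hom R F N. \<forall>b\<in>B. g b = h b"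
proof -
  interpret F: left_module R F by fact
  interpret N: left_module R N by fact
  define supp where "supp c = {b \<in> B. c b \<noteq> \<zero>\<^bsub>R\<^esub>}" for c
  define coords where "coords c x \<longleftrightarrow> c \<in> B \<rightarrow>\<^sub>E carrier R \<and> finite (supp c) \<and>
    x = (\<Oplus>\<^bsub>F\<^esub>b\<in>supp c. c b \<odot>\<^bsub>F\<^esub> b)" for c x
  have BF: "B \<subseteq> carrier F" and ex1: "\<And>x. x \<in> carrier F \<Longrightarrow> \<exists>!c. coords c x"
    using B by (simp_all add: is_module_basis_def coords_def supp_def)
  define C where "C x = (THE c. coords c x)" for x
  have C: "coords (C x) x" if "x \<in> carrier F" for x
    unfolding C_def by (rule theI'[OF ex1[OF that]])
  have C_R: "C x b \<in> carrier R" if "x \<in> carrier F" "b \<in> B" for x b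
    using C[OF that(1)] that(2) by (auto simp: coords_def)
  have C_fin: "finite (supp (C x))" if "x \<in> carrier F" for x
    using C[OF that] by (simp add: coords_def)
  have supp_B: "supp c \<subseteq> B" for c by (auto simp: supp_def)
  have C_sum: "x = (\<Oplus>\<^bsub>F\<^esub>b\<in>S. C x b \<odot>\<^bsub>F\<^esub> b)"
    if "x \<in> carrier F" "finite S" "S \<subseteq> B" "supp (C x) \<subseteq> S" for x S
  proof -
    have "x = (\<Oplus>\<^bsub>F\<^esub>b\<in>supp (C x). C x b \<odot>\<^bsub>F\<^esub> b)"
      using C[OF that(1)] by (simp add: coords_def)
    also have "\<dots> = (\<Oplus>\<^bsub>F\<^esub>b\<in>S. C x b \<odot>\<^bsub>F\<^esub> b)"
      using that BF C_R by (intro F.finsum_coeffs_superset) (auto simp: supp_def)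
    finally show ?thesis .
  qed
  have C_eqI: "C x = c"
    if "x \<in> carrier F" "c \<in> B \<rightarrow>\<^sub>E carrier R" "finite S" "S \<subseteq> B" "supp c \<subseteq> S"
      "x = (\<Oplus>\<^bsub>F\<^esub>b\<in>S. c b \<odot>\<^bsub>F\<^esub> b)" for x c S
  proof -
    have "(\<Oplus>\<^bsub>F\<^esub>b\<in>supp c. c b \<odot>\<^bsub>F\<^esub> b) = (\<Oplus>\<^bsub>F\<^esub>b\<in>S. c b \<odot>\<^bsub>F\<^esub> b)"
      using that BF by (intro F.finsum_coeffs_superset) (auto simp: supp_def)
    then have "coords c x"
      using that finite_subset[OF that(5,3)] by (simp add: coords_def)
    then show ?thesis
      using ex1[OF that(1)] C[OF that(1)] by blast
  qed
  define g where "g = (\<lambda>x\<in>carrier F. \<Oplus>\<^bsub>N\<^esub>b\<in>supp (C x). C x b \<odot>\<^bsub>N\<^esub> h b)"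
  have g_sum: "g x = (\<Oplus>\<^bsub>N\<^esub>b\<in>S. C x b \<odot>\<^bsub>N\<^esub> h b)"
    if "x \<in> carrier F" "finite S" "S \<subseteq> B" "supp (C x) \<subseteq> S" for x S
  proof -
    have "(\<Oplus>\<^bsub>N\<^esub>b\<in>supp (C x). C x b \<odot>\<^bsub>N\<^esub> h b) = (\<Oplus>\<^bsub>N\<^esub>b\<in>S. C x b \<odot>\<^bsub>N\<^esub> h b)"
      using that h C_R by (intro N.finsum_coeffs_superset) (auto simp: supp_def)
    then show ?thesis using that(1) by (simp add: g_def)
  qed
  have "g \<in> left_module_hom R F N"
  proof (rule left_module_homI)
    show "g \<in> carrier F \<rightarrow>\<^sub>E carrier N"
    proof (rule PiE_I)
      fix x assume x: "x \<in> carrier F"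
      have "(\<Oplus>\<^bsub>N\<^esub>b\<in>supp (C x). C x b \<odot>\<^bsub>N\<^esub> h b) \<in> carrier N"
        using C_R[OF x] h supp_B[of "C x"] by (intro N.M.finsum_closed) auto
      then show "g x \<in> carrier N" using x by (simp add: g_def)
    qed (simp add: g_def)
    fix x y assume xy: "x \<in> carrier F" "y \<in> carrier F"
    define S where "S = supp (C x) \<union> supp (C y)"
    have S: "finite S" "S \<subseteq> B" "supp (C x) \<subseteq> S" "supp (C y) \<subseteq> S"
      using xy C_fin supp_B by (auto simp: S_def)
    have SF: "b \<in> carrier F" "h b \<in> carrier N" "C x b \<in> carrier R" "C y b \<in> carrier R" if "b \<in> S" for b
      using that S(2) BF h C_R xy by auto
    have sum: "C (x \<oplus>\<^bsub>F\<^esub> y) = (\<lambda>b\<in>B. C x b \<oplus>\<^bsub>R\<^esub> C y b)" (is "_ = ?c")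
    proof (rule C_eqI[OF _ _ S(1,2)])
      show "supp ?c \<subseteq> S"
        using xy by (auto simp: supp_def S_def)
      have "x \<oplus>\<^bsub>F\<^esub> y = (\<Oplus>\<^bsub>F\<^esub>b\<in>S. C x b \<odot>\<^bsub>F\<^esub> b) \<oplus>\<^bsub>F\<^esub> (\<Oplus>\<^bsub>F\<^esub>b\<in>S. C y b \<odot>\<^bsub>F\<^esub> b)"
        using C_sum[OF xy(1) S(1,2,3)] C_sum[OF xy(2) S(1,2,4)] by simp
      also have "\<dots> = (\<Oplus>\<^bsub>F\<^esub>b\<in>S. C x b \<odot>\<^bsub>F\<^esub> b \<oplus>\<^bsub>F\<^esub> C y b \<odot>\<^bsub>F\<^esub> b)"
        using SF by (intro F.M.finsum_addf[symmetric]) auto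
      also have "\<dots> = (\<Oplus>\<^bsub>F\<^esub>b\<in>S. ?c b \<odot>\<^bsub>F\<^esub> b)"
        using SF S(2) by (intro F.M.finsum_cong') (auto simp: F.lsmult_l_distr subset_eq)
      finally show "x \<oplus>\<^bsub>F\<^esub> y = (\<Oplus>\<^bsub>F\<^esub>b\<in>S. ?c b \<odot>\<^bsub>F\<^esub> b)" .
    qed (use xy C_R in auto)
    have "g (x \<oplus>\<^bsub>F\<^esub> y) = (\<Oplus>\<^bsub>N\<^esub>b\<in>S. C (x \<oplus>\<^bsub>F\<^esub> y) b \<odot>\<^bsub>N\<^esub> h b)"
      using xy S by (intro g_sum) (auto simp: sum, auto simp: supp_def S_def)
    also have "\<dots> = (\<Oplus>\<^bsub>N\<^esub>b\<in>S. C x b \<odot>\<^bsub>N\<^esub> h b \<oplus>\<^bsub>N\<^esub> C y b \<odot>\<^bsub>N\<^esub> h b)"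
      using SF S(2) by (intro N.M.finsum_cong') (auto simp: sum N.lsmult_l_distr subset_eq)
    also have "\<dots> = (\<Oplus>\<^bsub>N\<^esub>b\<in>S. C x b \<odot>\<^bsub>N\<^esub> h b) \<oplus>\<^bsub>N\<^esub> (\<Oplus>\<^bsub>N\<^esub>b\<in>S. C y b \<odot>\<^bsub>N\<^esub> h b)"
      using SF by (intro N.M.finsum_addf) auto
    also have "\<dots> = g x \<oplus>\<^bsub>N\<^esub> g y"
      using g_sum[OF xy(1) S(1,2,3)] g_sum[OF xy(2) S(1,2,4)] by simp
    finally show "g (x \<oplus>\<^bsub>F\<^esub> y) = g x \<oplus>\<^bsub>N\<^esub> g y" .
  next
    fix a x assume ax: "a \<in> carrier R" "x \<in> carrier F"
    define S where "S = supp (C x)"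
    have S: "finite S" "S \<subseteq> B" "supp (C x) \<subseteq> S"
      using ax C_fin supp_B by (auto simp: S_def)
    have SF: "b \<in> carrier F" "h b \<in> carrier N" "C x b \<in> carrier R" if "b \<in> S" for b
      using that S(2) BF h C_R ax by auto
    have mult: "C (a \<odot>\<^bsub>F\<^esub> x) = (\<lambda>b\<in>B. a \<otimes>\<^bsub>R\<^esub> C x b)" (is "_ = ?c")
    proof (rule C_eqI[OF _ _ S(1,2)])
      show "supp ?c \<subseteq> S"
        using ax by (auto simp: supp_def S_def)
      have "a \<odot>\<^bsub>F\<^esub> x = a \<odot>\<^bsub>F\<^esub> (\<Oplus>\<^bsub>F\<^esub>b\<in>S. C x b \<odot>\<^bsub>F\<^esub> b)"
        using C_sum[OF ax(2) S] by simp
      also have "\<dots> = (\<Oplus>\<^bsub>F\<^esub>b\<in>S. a \<odot>\<^bsub>F\<^esub> (C x b \<odot>\<^bsub>F\<^esub> b))"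
        using SF S ax by (intro F.lsmult_finsum) auto
      also have "\<dots> = (\<Oplus>\<^bsub>F\<^esub>b\<in>S. ?c b \<odot>\<^bsub>F\<^esub> b)"
        using SF S(2) ax by (intro F.M.finsum_cong') (auto simp: F.lsmult_assoc subset_eq)
      finally show "a \<odot>\<^bsub>F\<^esub> x = (\<Oplus>\<^bsub>F\<^esub>b\<in>S. ?c b \<odot>\<^bsub>F\<^esub> b)" .
    qed (use ax C_R in auto)
    have "g (a \<odot>\<^bsub>F\<^esub> x) = (\<Oplus>\<^bsub>N\<^esub>b\<in>S. C (a \<odot>\<^bsub>F\<^esub> x) b \<odot>\<^bsub>N\<^esub> h b)"
      using ax S by (intro g_sum) (auto simp: mult, auto simp: supp_def S_def)
    also have "\<dots> = (\<Oplus>\<^bsub>N\<^esub>b\<in>S. a \<odot>\<^bsub>N\<^esub> (C x b \<odot>\<^bsub>N\<^esub> h b))"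
      using SF S(2) ax by (intro N.M.finsum_cong') (auto simp: mult N.lsmult_assoc subset_eq)
    also have "\<dots> = a \<odot>\<^bsub>N\<^esub> (\<Oplus>\<^bsub>N\<^esub>b\<in>S. C x b \<odot>\<^bsub>N\<^esub> h b)"
      using SF S ax by (intro N.lsmult_finsum[symmetric]) auto
    also have "\<dots> = a \<odot>\<^bsub>N\<^esub> g x"
      using g_sum[OF ax(2) S] by simp
    finally show "g (a \<odot>\<^bsub>F\<^esub> x) = a \<odot>\<^bsub>N\<^esub> g x" .
  qed
  moreover have "g b = h b" if b: "b \<in> B" for b
  proof -
    have bF: "b \<in> carrier F" and hb: "h b \<in> carrier N" using b BF h by auto
    have C_b: "C b = (\<lambda>b'\<in>B. if b' = b then \<one>\<^bsub>R\<^esub> else \<zero>\<^bsub>R\<^esub>)" (is "_ = ?c")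
    proof (rule C_eqI[of _ _ "{b}"])
      show "b = (\<Oplus>\<^bsub>F\<^esub>b\<in>{b}. ?c b \<odot>\<^bsub>F\<^esub> b)"
        using b bF by simp
    qed (use b bF in \<open>auto simp: supp_def split: if_splits\<close>)
    have "g b = (\<Oplus>\<^bsub>N\<^esub>b'\<in>{b}. C b b' \<odot>\<^bsub>N\<^esub> h b')"
      using b by (intro g_sum[OF bF]) (auto simp: C_b supp_def split: if_splits)
    also have "\<dots> = h b"
      using b hb by (simp add: C_b)
    finally show ?thesis .
  qed
  ultimately show ?thesis by blast
qed

lemma module_basis_hom_eq:
  assumes B: "is_module_basis R F B" and f: "left_module_map R F N f" and g: "left_module_map R F N g"
    and eq: "\<And>b. b \<in> B \<Longrightarrow> f b = g b" and x: "x \<in> carrier F"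
  shows "f x = g x"
proof -
  interpret f: left_module_map R F N f by fact
  interpret g: left_module_map R F N g by fact
  have "\<exists>c. c \<in> B \<rightarrow>\<^sub>E carrier R \<and> finite {b \<in> B. c b \<noteq> \<zero>\<^bsub>R\<^esub>} \<and>
      x = (\<Oplus>\<^bsub>F\<^esub>b\<in>{b \<in> B. c b \<noteq> \<zero>\<^bsub>R\<^esub>}. c b \<odot>\<^bsub>F\<^esub> b)"
    using B x unfolding is_module_basis_def by blast
  then obtain c where c: "c \<in> B \<rightarrow>\<^sub>E carrier R" "finite {b \<in> B. c b \<noteq> \<zero>\<^bsub>R\<^esub>}"
      "x = (\<Oplus>\<^bsub>F\<^esub>b\<in>{b \<in> B. c b \<noteq> \<zero>\<^bsub>R\<^esub>}. c b \<odot>\<^bsub>F\<^esub> b)"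
    by blast
  have B': "b \<in> carrier F" "c b \<in> carrier R" if "b \<in> B" for b
    using that B c(1) by (auto simp: is_module_basis_def)
  have "f x = (\<Oplus>\<^bsub>N\<^esub>b\<in>{b \<in> B. c b \<noteq> \<zero>\<^bsub>R\<^esub>}. f (c b \<odot>\<^bsub>F\<^esub> b))"
    unfolding c(3) using B' by (intro f.finsum c(2)) auto
  also have "\<dots> = (\<Oplus>\<^bsub>N\<^esub>b\<in>{b \<in> B. c b \<noteq> \<zero>\<^bsub>R\<^esub>}. g (c b \<odot>\<^bsub>F\<^esub> b))"
    using B' by (intro f.N.M.finsum_cong') (auto simp: f.smult g.smult eq)
  also have "\<dots> = g x"
    using B' c(2) by (subst c(3)) (intro g.finsum[symmetric]; auto)
  finally show ?thesis .
qed

text \<open>Free modules are projective: choose preimages of the basis elements and extend linearly.\<close>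

lemma free_module_lift:
  assumes F: "is_free_module R F" and t: "left_module_map R L N t"
    and f: "left_module_map R F N f" and im: "f ` carrier F \<subseteq> t ` carrier L"
  shows "\<exists>g\<in>left_module_hom R F L. \<forall>x\<in>carrier F. t (g x) = f x"
proof -
  interpret t: left_module_map R L N t by fact
  interpret f: left_module_map R F N f by fact
  obtain B where B: "is_module_basis R F B"
    using F by (auto simp: is_free_module_def)
  then have BF: "B \<subseteq> carrier F" by (simp add: is_module_basis_def)
  define h where "h b = (SOME y. y \<in> carrier L \<and> t y = f b)" for b
  have h: "h b \<in> carrier L \<and> t (h b) = f b" if "b \<in> B" for b
  proof -
    have "f b \<in> t ` carrier L" using im BF that by blast
    then have "\<exists>y. y \<in> carrier L \<and> t y = f b" by (elim imageE) (intro exI conjI, assumption, rule sym)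
    then show ?thesis unfolding h_def by (rule someI_ex)
  qed
  then have h_Pi: "h \<in> B \<rightarrow> carrier L" by blast
  obtain g where g: "g \<in> left_module_hom R F L" "\<forall>b\<in>B. g b = h b"
    using free_module_extend[OF f.M.left_module_axioms B t.M.left_module_axioms h_Pi] by blast
  have "left_module_map R F N (compose (carrier F) t g)"
    by (intro left_module_mapI left_module_hom_compose[OF t.hom g(1)]
        f.M.left_module_axioms t.N.left_module_axioms)
  from module_basis_hom_eq[OF B this f]
  have "compose (carrier F) t g x = f x" if "x \<in> carrier F" for x
    using that h g(2) BF by (simp add: compose_def subset_eq)
  then show ?thesis
    using g(1) by (intro bexI[of _ g]) (auto simp: compose_def)
qed

section \<open>Vanishing of Ext\<close>

text \<open>
  In an exact sequence \<open>C \<rightarrow> A \<rightarrow> B\<close> with \<open>A\<close> free, a splitting of \<open>d : A \<rightarrow> B\<close> gives one of \<open>t : C \<rightarrow> A\<close>: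
  the equation \<open>dsd = d\<close> makes \<open>1 - sd\<close> a projection of \<open>A\<close> onto \<open>ker d = im t\<close>, and the freeness of \<open>A\<close>
  lifts this projection along \<open>t\<close>. The condition \<open>dsd = d\<close> is chosen, rather than a section of \<open>d\<close>,
  because it reproduces itself for maps that are not surjective.
\<close>

lemma splitting_step:
  assumes free: "is_free_module R A"
    and d: "left_module_map R A B d" and s: "left_module_map R B A s"
    and t: "left_module_map R C A t"
    and exact: "t ` carrier C = a_kernel A B d"
    and dsd: "\<And>x. x \<in> carrier A \<Longrightarrow> d (s (d x)) = d x"
  shows "\<exists>s'. left_module_map R A C s' \<and> (\<forall>x\<in>carrier C. t (s' (t x)) = t x)"
proof -
  interpret d: left_module_map R A B d by fact
  interpret s: left_module_map R B A s by fact
  interpret t: left_module_map R C A t by fact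
  have A: "left_module R A" and C: "left_module R C"
    by (rule d.M.left_module_axioms, rule t.M.left_module_axioms)
  have sd: "compose (carrier A) s d \<in> left_module_hom R A A"
    by (rule left_module_hom_compose[OF s.hom d.hom A])
  have id: "(\<lambda>x\<in>carrier A. x) \<in> left_module_hom R A A"
    by (rule left_module_homI) auto
  define r where "r = (\<lambda>x\<in>carrier A. (\<lambda>x\<in>carrier A. x) x \<oplus>\<^bsub>A\<^esub>
      (\<lambda>x\<in>carrier A. \<ominus>\<^bsub>A\<^esub> compose (carrier A) s d x) x)"
  have r: "left_module_map R A A r"
    unfolding r_def
    by (intro left_module_mapI A left_module_hom_add left_module_hom_uminus id sd)
  have r_eq: "r x = x \<ominus>\<^bsub>A\<^esub> s (d x)" if "x \<in> carrier A" for x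
    using that by (simp add: r_def compose_def a_minus_def)
  have im: "r x \<in> t ` carrier C" if x: "x \<in> carrier A" for x
  proof -
    have "d (r x) = d x \<ominus>\<^bsub>B\<^esub> d (s (d x))"
      unfolding r_eq[OF x] by (intro d.minus x s.closed d.closed)
    also have "\<dots> = \<zero>\<^bsub>B\<^esub>"
      unfolding dsd[OF x] using x by (simp add: a_minus_def d.N.M.r_neg)
    finally have "r x \<in> a_kernel A B d"
      using x left_module_map.closed[OF r x] by (intro iffD2[OF mem_a_kernel] conjI)
    then show ?thesis using exact by blast
  qed
  obtain s' where s': "s' \<in> left_module_hom R A C" "\<forall>x\<in>carrier A. t (s' x) = r x"
    using free_module_lift[OF free t r] im by blast
  have "t (s' (t x)) = t x" if x: "x \<in> carrier C" for x
  proof -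
    have tx: "t x \<in> carrier A" using x by simp
    have "t x \<in> a_kernel A B d" using x exact by blast
    then have dtx: "d (t x) = \<zero>\<^bsub>B\<^esub>" by (rule conjunct2[OF iffD1[OF mem_a_kernel]])
    have "t (s' (t x)) = t x \<ominus>\<^bsub>A\<^esub> s (d (t x))"
      using s'(2) tx r_eq by simp
    also have "\<dots> = t x"
      unfolding dtx s.hom_zero using tx by (simp add: a_minus_def)
    finally show ?thesis .
  qed
  then show ?thesis
    using left_module_mapI[OF A C s'(1)] by blast
qed

lemma free_resolution_maps:
  assumes "free_resolution R M P \<delta> \<epsilon>" "left_module R M"
  shows "left_module R (P i)" "left_module_map R (P 0) M \<epsilon>"
    "left_module_map R (P (Suc i)) (P i) (\<delta> i)"
proof -
  show P: "left_module R (P i)" for i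
    using assms(1) by (auto simp: free_resolution_def is_free_module_def)
  show "left_module_map R (P 0) M \<epsilon>" "left_module_map R (P (Suc i)) (P i) (\<delta> i)"
    using assms(1) by (auto simp: free_resolution_def intro!: left_module_mapI P assms(2))
qed

lemma free_resolution_split:
  assumes res: "free_resolution R M P \<delta> \<epsilon>" and M: "left_module R M"
    and s: "s \<in> left_module_hom R M (P 0)" "\<And>x. x \<in> carrier M \<Longrightarrow> \<epsilon> (s x) = x"
  shows "\<exists>\<sigma>. left_module_map R (P i) (P (Suc i)) \<sigma> \<and>
    (\<forall>x\<in>carrier (P (Suc i)). \<delta> i (\<sigma> (\<delta> i x)) = \<delta> i x)"
proof (induction i)
  case 0
  have "left_module_map R M (P 0) s"
    by (rule left_module_mapI[OF M free_resolution_maps(1)[OF res M] s(1)])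
  moreover have "\<epsilon> (s (\<epsilon> x)) = \<epsilon> x" if "x \<in> carrier (P 0)" for x
    using left_module_map.closed[OF free_resolution_maps(2)[OF res M] that] by (rule s(2))
  ultimately show ?case
    using res unfolding free_resolution_def
    by (intro splitting_step[OF _ free_resolution_maps(2)[OF res M]] free_resolution_maps[OF res M])
      auto
next
  case (Suc i)
  then obtain \<sigma> where "left_module_map R (P i) (P (Suc i)) \<sigma>"
      "\<And>x. x \<in> carrier (P (Suc i)) \<Longrightarrow> \<delta> i (\<sigma> (\<delta> i x)) = \<delta> i x"
    by blast
  moreover have "is_free_module R (P (Suc i))"
      "\<delta> (Suc i) ` carrier (P (Suc (Suc i))) = a_kernel (P (Suc i)) (P i) (\<delta> i)"
    using res by (simp_all add: free_resolution_def)
  ultimately show ?case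
    by (intro splitting_step[OF _ free_resolution_maps(3)[OF res M]] free_resolution_maps[OF res M])
qed

lemma comm_group_hom_group:
  assumes "left_module R M" "left_module R N"
  shows "comm_group (hom_group R M N)"
proof -
  interpret M: left_module R M by fact
  interpret N: left_module R N by fact
  have N: "f x \<in> carrier N" if "f \<in> left_module_hom R M N" "x \<in> carrier M" for f x
    using that by (auto simp: left_module_hom_def)
  show ?thesis
  proof (rule comm_groupI)
    fix f assume "f \<in> carrier (hom_group R M N)"
    then have f: "f \<in> left_module_hom R M N" by (simp add: hom_group_def)
    show "\<one>\<^bsub>hom_group R M N\<^esub> \<otimes>\<^bsub>hom_group R M N\<^esub> f = f"
      unfolding hom_group_def monoid.simps
      by (rule left_module_hom_eqI[OF left_module_hom_add[OF assms left_module_hom_zero[OF assms] f] f])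
        (simp add: N[OF f])
    show "\<exists>g\<in>carrier (hom_group R M N). g \<otimes>\<^bsub>hom_group R M N\<^esub> f = \<one>\<^bsub>hom_group R M N\<^esub>"
      by (rule bexI[of _ "\<lambda>x\<in>carrier M. \<ominus>\<^bsub>N\<^esub> f x"])
        (auto simp: hom_group_def N[OF f] N.M.l_neg intro!: restrict_ext left_module_hom_uminus[OF assms f])
  qed (auto simp: hom_group_def N N.M.a_ac
      intro!: restrict_ext left_module_hom_add[OF assms] left_module_hom_zero[OF assms])
qed

lemma group_hom_compose:
  assumes "left_module R N" and \<delta>: "left_module_map R L M \<delta>"
  shows "group_hom (hom_group R M N) (hom_group R L N) (\<lambda>f. compose (carrier L) f \<delta>)"
proof -
  interpret \<delta>: left_module_map R L M \<delta> by fact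
  have L: "left_module R L" and M: "left_module R M"
    by (rule \<delta>.M.left_module_axioms, rule \<delta>.N.left_module_axioms)
  show ?thesis
  proof (intro group_hom.intro group_hom_axioms.intro homI
      comm_group.axioms(2)[OF comm_group_hom_group] L M assms(1))
    fix f assume "f \<in> carrier (hom_group R M N)"
    then show "compose (carrier L) f \<delta> \<in> carrier (hom_group R L N)"
      using left_module_hom_compose[OF _ \<delta>.hom L] by (simp add: hom_group_def)
  qed (auto simp: hom_group_def compose_def intro!: restrict_ext)
qed

lemma trivial_group_Mod_self:
  assumes "group G"
  shows "trivial_group (G Mod carrier G)"
proof -
  interpret group G by fact
  have normal: "carrier G \<lhd> G"
    by (simp add: normal_inv_iff subgroup_self)
  have "rcosets\<^bsub>G\<^esub> carrier G = {carrier G}"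
    using coset_join2[OF _ subgroup_self] one_closed by (auto simp: RCOSETS_def)
  then show ?thesis
    using normal.factorgroup_is_group[OF normal]
    by (simp add: trivial_group_def FactGroup_def)
qed

text \<open>
  If \<open>\<epsilon>\<close> splits, all maps of the resolution split as \<open>\<delta>\<sigma>\<delta> = \<delta>\<close>. A cocycle \<open>f\<close> vanishes on
  \<open>im \<delta>\<^sub>i = ker \<delta>\<^sub>j\<close>, which contains \<open>x - \<sigma>\<^sub>j\<delta>\<^sub>j x\<close>; hence \<open>f = (f\<sigma>\<^sub>j)\<delta>\<^sub>j\<close> is a coboundary, where \<open>i = j + 1\<close>.
\<close>

lemma ext_group_trivial:
  assumes res: "free_resolution R M P \<delta> \<epsilon>" and M: "left_module R M" and N: "left_module R N"
    and s: "s \<in> left_module_hom R M (P 0)" "\<And>x. x \<in> carrier M \<Longrightarrow> \<epsilon> (s x) = x"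
    and i: "i \<ge> 1"
  shows "trivial_group (ext_group R P \<delta> N i)"
proof -
  obtain j where j: "i = Suc j" using i by (cases i) auto
  let ?Z = "ext_cocycles R P \<delta> N (Suc j)"
  note P = free_resolution_maps(1)[OF res M] and map = free_resolution_maps(3)[OF res M]
  interpret \<delta>: left_module_map R "P (Suc j)" "P j" "\<delta> j" by (rule map)
  interpret \<delta>': left_module_map R "P (Suc (Suc j))" "P (Suc j)" "\<delta> (Suc j)" by (rule map)
  have exact: "\<delta> (Suc j) ` carrier (P (Suc (Suc j))) = a_kernel (P (Suc j)) (P j) (\<delta> j)"
    using res by (simp add: free_resolution_def)
  obtain \<sigma> where \<sigma>: "left_module_map R (P j) (P (Suc j)) \<sigma>"
      "\<And>x. x \<in> carrier (P (Suc j)) \<Longrightarrow> \<delta> j (\<sigma> (\<delta> j x)) = \<delta> j x"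
    using free_resolution_split[OF res M s] by blast
  interpret \<sigma>: left_module_map R "P j" "P (Suc j)" \<sigma> by (rule \<sigma>(1))
  have cocycle_iff: "f \<in> ?Z \<longleftrightarrow> f \<in> left_module_hom R (P (Suc j)) N \<and>
      (\<forall>x\<in>carrier (P (Suc (Suc j))). f (\<delta> (Suc j) x) = \<zero>\<^bsub>N\<^esub>)" for f
    by (auto simp: ext_cocycles_def kernel_def hom_group_def compose_def restrict_def fun_eq_iff)
  have "ext_coboundaries R P \<delta> N (Suc j) = ?Z"
  proof (intro equalityI subsetI)
    fix f assume "f \<in> ext_coboundaries R P \<delta> N (Suc j)"
    then obtain g where g: "g \<in> left_module_hom R (P j) N"
        and f: "f = compose (carrier (P (Suc j))) g (\<delta> j)"
      by (auto simp: ext_coboundaries_def hom_group_def)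
    interpret g: left_module_map R "P j" N g by (rule left_module_mapI[OF P N g])
    have "f (\<delta> (Suc j) x) = \<zero>\<^bsub>N\<^esub>" if x: "x \<in> carrier (P (Suc (Suc j)))" for x
    proof -
      have "\<delta> (Suc j) x \<in> a_kernel (P (Suc j)) (P j) (\<delta> j)" using exact x by blast
      then have "\<delta> j (\<delta> (Suc j) x) = \<zero>\<^bsub>P j\<^esub>" by (rule conjunct2[OF iffD1[OF mem_a_kernel]])
      then show ?thesis
        using \<delta>'.closed[OF x] g.hom_zero by (simp only: f compose_eq)
    qed
    then show "f \<in> ?Z"
      unfolding cocycle_iff f using left_module_hom_compose[OF g \<delta>.hom P] by blast
  next
    fix f assume "f \<in> ?Z"
    then have f: "f \<in> left_module_hom R (P (Suc j)) N"
        and f0: "\<And>x. x \<in> carrier (P (Suc (Suc j))) \<Longrightarrow> f (\<delta> (Suc j) x) = \<zero>\<^bsub>N\<^esub>"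
      unfolding cocycle_iff by blast+
    interpret f: left_module_map R "P (Suc j)" N f by (rule left_module_mapI[OF P N f])
    have fx: "f x = f (\<sigma> (\<delta> j x))" if x: "x \<in> carrier (P (Suc j))" for x
    proof -
      let ?y = "x \<ominus>\<^bsub>P (Suc j)\<^esub> \<sigma> (\<delta> j x)"
      have y: "?y \<in> carrier (P (Suc j))"
        by (intro \<delta>.M.M.minus_closed x \<sigma>.closed \<delta>.closed)
      have "\<delta> j ?y = \<delta> j x \<ominus>\<^bsub>P j\<^esub> \<delta> j (\<sigma> (\<delta> j x))"
        by (intro \<delta>.minus x \<sigma>.closed \<delta>.closed)
      also have "\<dots> = \<zero>\<^bsub>P j\<^esub>"
        unfolding \<sigma>(2)[OF x] using x by (simp add: a_minus_def \<delta>.N.M.r_neg)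
      finally have "?y \<in> a_kernel (P (Suc j)) (P j) (\<delta> j)"
        using y by (intro iffD2[OF mem_a_kernel] conjI)
      then obtain z where "z \<in> carrier (P (Suc (Suc j)))" "?y = \<delta> (Suc j) z"
        unfolding exact[symmetric] by blast
      then have "f ?y = \<zero>\<^bsub>N\<^esub>" using f0 by (simp only:)
      moreover have "?y \<oplus>\<^bsub>P (Suc j)\<^esub> \<sigma> (\<delta> j x) = x"
        by (intro \<delta>.M.M.minus_add_cancel_right x \<sigma>.closed \<delta>.closed)
      moreover have "f (?y \<oplus>\<^bsub>P (Suc j)\<^esub> \<sigma> (\<delta> j x)) = f ?y \<oplus>\<^bsub>N\<^esub> f (\<sigma> (\<delta> j x))"
        by (intro f.add y \<sigma>.closed \<delta>.closed x)
      moreover have "f (\<sigma> (\<delta> j x)) \<in> carrier N"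
        by (intro f.closed \<sigma>.closed \<delta>.closed x)
      ultimately show ?thesis
        by (simp only: f.N.M.l_zero)
    qed
    have "f = compose (carrier (P (Suc j))) (compose (carrier (P j)) f \<sigma>) (\<delta> j)"
      by (rule left_module_hom_eqI[OF f
            left_module_hom_compose[OF left_module_hom_compose[OF f \<sigma>.hom P] \<delta>.hom P]])
        (simp add: compose_def fx[symmetric])
    then show "f \<in> ext_coboundaries R P \<delta> N (Suc j)"
      using left_module_hom_compose[OF f \<sigma>.hom P] by (auto simp: ext_coboundaries_def hom_group_def)
  qed
  moreover have "group ((hom_group R (P (Suc j)) N)\<lparr>carrier := ?Z\<rparr>)"
    unfolding ext_cocycles_def
    using group_hom.subgroup_kernel[OF group_hom_compose[OF N map]]
      comm_group.axioms(2)[OF comm_group_hom_group[OF P N]]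
    by (intro subgroup.subgroup_is_group)
  from trivial_group_Mod_self[OF this]
  have "trivial_group ((hom_group R (P (Suc j)) N)\<lparr>carrier := ?Z\<rparr> Mod ?Z)" by simp
  ultimately show ?thesis
    by (simp add: j ext_group_def)
qed

section \<open>Quotient modules and projectivity\<close>

context
  fixes R (structure) and M :: "('a, 'b) module" and H :: "'b set"
  assumes M: "left_module R M" and H: "submodule H R M"
begin

interpretation left_module R M by (rule M)
interpretation H: submodule H R M by (rule H)
interpretation abelian_subgroup H M
  using H.subgroup_axioms by (intro abelian_subgroupI3 additive_subgroupI) (auto intro: M.abelian_group_axioms)

lemma quotient_module_carrier: "carrier (quotient_module M H) = (\<lambda>x. H +>\<^bsub>M\<^esub> x) ` carrier M"
  by (auto simp: quotient_module_def A_RCOSETS_def')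

lemma quotient_module_add:
  assumes "x \<in> carrier M" "y \<in> carrier M"
  shows "(H +>\<^bsub>M\<^esub> x) \<oplus>\<^bsub>quotient_module M H\<^esub> (H +>\<^bsub>M\<^esub> y) = H +>\<^bsub>M\<^esub> (x \<oplus>\<^bsub>M\<^esub> y)"
  using assms by (simp add: quotient_module_def a_rcos_sum)

lemma coset_eqI:
  assumes "h \<in> H" "y \<in> carrier M" "x = h \<oplus>\<^bsub>M\<^esub> y"
  shows "H +>\<^bsub>M\<^esub> x = H +>\<^bsub>M\<^esub> y"
proof -
  have "x \<in> H +>\<^bsub>M\<^esub> y" using assms by (auto simp: a_r_coset_def')
  then show ?thesis
    using assms(2) H.subgroup_axioms by (intro a_repr_independence[symmetric]) auto
qed

lemma coset_memE:
  assumes "y \<in> H +>\<^bsub>M\<^esub> x"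
  obtains h where "h \<in> H" "h \<in> carrier M" "y = h \<oplus>\<^bsub>M\<^esub> x"
  using assms a_subset by (auto simp: a_r_coset_def')

lemma coset_self: "x \<in> carrier M \<Longrightarrow> x \<in> H +>\<^bsub>M\<^esub> x"
  by (rule a_rcos_self)

lemma quotient_module_smult:
  assumes a: "a \<in> carrier R" and x: "x \<in> carrier M"
  shows "a \<odot>\<^bsub>quotient_module M H\<^esub> (H +>\<^bsub>M\<^esub> x) = H +>\<^bsub>M\<^esub> (a \<odot>\<^bsub>M\<^esub> x)"
proof -
  have "H +>\<^bsub>M\<^esub> (a \<odot>\<^bsub>M\<^esub> y) = H +>\<^bsub>M\<^esub> (a \<odot>\<^bsub>M\<^esub> x)" if y: "y \<in> H +>\<^bsub>M\<^esub> x" for y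
  proof -
    obtain h where h: "h \<in> H" "h \<in> carrier M" "y = h \<oplus>\<^bsub>M\<^esub> x"
      using y by (rule coset_memE)
    show ?thesis
      by (rule coset_eqI[OF H.smult_closed[OF a h(1)]])
        (simp_all add: h a x lsmult_r_distr del: a_rcos_const)
  qed
  moreover have "x \<in> H +>\<^bsub>M\<^esub> x"
    by (rule coset_self[OF x])
  ultimately have "(\<Union>y\<in>H +>\<^bsub>M\<^esub> x. H +>\<^bsub>M\<^esub> (a \<odot>\<^bsub>M\<^esub> y)) = H +>\<^bsub>M\<^esub> (a \<odot>\<^bsub>M\<^esub> x)"
    by blast
  then show ?thesis
    by (simp only: quotient_module_def module.simps)
qed

lemma quotient_module_induced_hom:
  assumes f: "left_module_map R M N f" and ker: "H \<subseteq> a_kernel M N f"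
  shows "\<exists>g\<in>left_module_hom R (quotient_module M H) N. \<forall>x\<in>carrier M. g (H +>\<^bsub>M\<^esub> x) = f x"
proof -
  interpret f: left_module_map R M N f by (rule f)
  define g where "g = (\<lambda>C\<in>carrier (quotient_module M H). f (SOME x. x \<in> C))"
  have f_coset: "f y = f x" if y: "y \<in> H +>\<^bsub>M\<^esub> x" and x: "x \<in> carrier M" for x y
  proof -
    obtain h where h: "h \<in> H" "h \<in> carrier M" "y = h \<oplus>\<^bsub>M\<^esub> x"
      using y by (rule coset_memE)
    have "f h = \<zero>\<^bsub>N\<^esub>"
      using ker h(1) by (blast intro: conjunct2[OF iffD1[OF mem_a_kernel]])
    moreover have "f y = f h \<oplus>\<^bsub>N\<^esub> f x"
      unfolding h(3) by (rule f.add[OF h(2) x])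
    ultimately show ?thesis
      using f.N.M.l_zero[OF f.closed[OF x]] by (simp only:)
  qed
  have g: "g (H +>\<^bsub>M\<^esub> x) = f x" if x: "x \<in> carrier M" for x
  proof -
    have "(SOME y. y \<in> H +>\<^bsub>M\<^esub> x) \<in> H +>\<^bsub>M\<^esub> x"
      by (rule someI[of "\<lambda>y. y \<in> H +>\<^bsub>M\<^esub> x", OF coset_self[OF x]])
    then have "f (SOME y. y \<in> H +>\<^bsub>M\<^esub> x) = f x" by (rule f_coset[OF _ x])
    moreover have "H +>\<^bsub>M\<^esub> x \<in> carrier (quotient_module M H)"
      unfolding quotient_module_carrier using x by (rule imageI)
    ultimately show ?thesis by (simp only: g_def restrict_apply if_True)
  qed
  have "g \<in> left_module_hom R (quotient_module M H) N"
  proof (rule left_module_homI)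
    show "g \<in> carrier (quotient_module M H) \<rightarrow>\<^sub>E carrier N"
    proof (rule PiE_I)
      fix C assume "C \<in> carrier (quotient_module M H)"
      then show "g C \<in> carrier N"
        unfolding quotient_module_carrier by (elim imageE) (simp only: g f.closed)
    qed (simp add: g_def)
  next
    fix C D assume "C \<in> carrier (quotient_module M H)" "D \<in> carrier (quotient_module M H)"
    then obtain x y where "x \<in> carrier M" "C = H +>\<^bsub>M\<^esub> x" "y \<in> carrier M" "D = H +>\<^bsub>M\<^esub> y"
      unfolding quotient_module_carrier by blast
    then show "g (C \<oplus>\<^bsub>quotient_module M H\<^esub> D) = g C \<oplus>\<^bsub>N\<^esub> g D"
      by (simp only: quotient_module_add g M.a_closed f.add)
  next
    fix a C assume "a \<in> carrier R" "C \<in> carrier (quotient_module M H)"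
    then obtain x where "a \<in> carrier R" "x \<in> carrier M" "C = H +>\<^bsub>M\<^esub> x"
      unfolding quotient_module_carrier by blast
    then show "g (a \<odot>\<^bsub>quotient_module M H\<^esub> C) = a \<odot>\<^bsub>N\<^esub> g C"
      by (simp only: quotient_module_smult g lsmult_closed f.smult)
  qed
  then show ?thesis using g by blast
qed

end

lemma generated_submodule_least:
  "submodule K R M \<Longrightarrow> S \<subseteq> K \<Longrightarrow> generated_submodule R M S \<subseteq> K"
  by (auto simp: generated_submodule_def)

lemma generated_submodule_generator: "x \<in> S \<Longrightarrow> x \<in> generated_submodule R M S"
  by (auto simp: generated_submodule_def)

text \<open>
  A one-element dual basis: if \<open>m\<close> and \<open>g\<close> satisfy \<open>x = g(x) m\<close> for all \<open>x\<close>, then \<open>M\<close> is projective. Given a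
  surjection \<open>e\<close>, a preimage \<open>a\<close> of \<open>m\<close> defines the section \<open>x \<mapsto> g(x) a\<close>.
\<close>

lemma dual_basis_section:
  assumes g: "left_module_map R M (regular_module R) g" and m: "m \<in> carrier M"
    and dual: "\<And>x. x \<in> carrier M \<Longrightarrow> g x \<odot>\<^bsub>M\<^esub> m = x"
    and e: "left_module_map R A M e" and surj: "e ` carrier A = carrier M"
  shows "\<exists>s\<in>left_module_hom R M A. \<forall>x\<in>carrier M. e (s x) = x"
proof -
  interpret g: left_module_map R M "regular_module R" g by fact
  interpret e: left_module_map R A M e by fact
  have "m \<in> e ` carrier A" using m surj by (simp only:)
  then obtain a where a: "a \<in> carrier A" "e a = m"
    by (elim imageE) (simp only:)
  have g_R: "g x \<in> carrier R" if "x \<in> carrier M" for x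
    using g.closed[OF that] by (simp add: regular_module_def)
  have g_add: "g (x \<oplus>\<^bsub>M\<^esub> y) = g x \<oplus>\<^bsub>R\<^esub> g y" if "x \<in> carrier M" "y \<in> carrier M" for x y
    using g.add[OF that] by (simp add: regular_module_def)
  have g_smult: "g (b \<odot>\<^bsub>M\<^esub> x) = b \<otimes>\<^bsub>R\<^esub> g x" if "b \<in> carrier R" "x \<in> carrier M" for b x
    using g.smult[OF that] by (simp add: regular_module_def)
  let ?s = "\<lambda>x\<in>carrier M. g x \<odot>\<^bsub>A\<^esub> a"
  have "?s \<in> left_module_hom R M A"
  proof (rule left_module_homI)
    fix x y assume "x \<in> carrier M" "y \<in> carrier M"
    then show "?s (x \<oplus>\<^bsub>M\<^esub> y) = ?s x \<oplus>\<^bsub>A\<^esub> ?s y"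
      using a(1) by (simp add: g_R g_add e.M.lsmult_l_distr del: g.add g.hom_add)
  next
    fix b x assume "b \<in> carrier R" "x \<in> carrier M"
    then show "?s (b \<odot>\<^bsub>M\<^esub> x) = b \<odot>\<^bsub>A\<^esub> ?s x"
      using a(1) by (simp add: g_R g_smult e.M.lsmult_assoc)
  qed (auto simp: g_R a(1))
  moreover have "e (?s x) = x" if "x \<in> carrier M" for x
    using that by (simp add: e.smult[OF g_R a(1)] a(2) dual)
  ultimately show ?thesis by blast
qed

section \<open>Arithmetic of differential operators\<close>

lemma diffop_const_minus: "diffop_const (- a) = - diffop_const a"
  by (simp add: diffop_const_def single_uminus)

lemma diffop_const_diff: "diffop_const (a - b) = diffop_const a - diffop_const b"
  by (simp add: diffop_const_def single_diff)

lemma diffop_mult_0_right [simp]: "diffop_mult P 0 = 0"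
  using diffop_mult_add_right[of P 0 0] by (simp only: add_0_left add_cancel_right_right)

lemma diffop_mult_minus_left: "diffop_mult (- P) Q = - diffop_mult P Q"
  using diffop_mult_add_left[of "- P" P Q] by (simp add: add_eq_0_iff)

lemma diffop_mult_minus_right: "diffop_mult P (- Q) = - diffop_mult P Q"
  using diffop_mult_add_right[of P "- Q" Q] by (simp add: add_eq_0_iff)

lemma diffop_mult_diff_left: "diffop_mult (P - P') Q = diffop_mult P Q - diffop_mult P' Q"
  using diffop_mult_add_left[of P "- P'" Q] by (simp add: diffop_mult_minus_left)

lemma diffop_mult_diff_right: "diffop_mult P (Q - Q') = diffop_mult P Q - diffop_mult P Q'"
  using diffop_mult_add_right[of P Q "- Q'"] by (simp add: diffop_mult_minus_right)

lemma diffop_mult_sum_left: "diffop_mult (sum f S) Q = (\<Sum>s\<in>S. diffop_mult (f s) Q)"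
  by (induction S rule: infinite_finite_induct) (simp_all add: diffop_mult_add_left)

lemma diffop_mult_sum_right: "diffop_mult P (sum f S) = (\<Sum>s\<in>S. diffop_mult P (f s))"
  by (induction S rule: infinite_finite_induct) (simp_all add: diffop_mult_add_right)

lemma d_const:
  "diffop_mult (diffop_d i) (diffop_const a) = diffop_const a * diffop_d i + diffop_const (pd i a)"
  by (simp add: diffop_mult_d d_mult_def map_pd_const mult.commute)

section \<open>Contact fields and their generating functions\<close>

lemma pd_contact_form: "pd k (contact_form p i) = (if i \<in> {1..p} \<and> k = i + p then - 1 else 0)"
  by (simp add: contact_form_def pd_minus pd_coord)

text \<open>
  The contact field with generating function \<open>f\<close> has the components \<open>\<xi>\<^sup>r = contact_field_op p r f\<close>, that is
  \<open>\<xi>\<^sup>a = - \<partial>f/\<partial>x\<^bsup>a+p\<^esup>\<close>, \<open>\<xi>\<^bsup>a+p\<^esup> = \<partial>f/\<partial>x\<^sup>a + x\<^bsup>a+p\<^esup> \<partial>f/\<partial>x\<^sup>n\<close> and \<open>\<xi>\<^sup>n = f - \<Sum>\<^sub>a x\<^bsup>a+p\<^esup> \<partial>f/\<partial>x\<^bsup>a+p\<^esup>\<close>. They are the solution of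
  \<open>\<alpha>(\<xi>) = f\<close> and \<open>df + \<iota>\<^sub>\<xi> d\<alpha> = (\<partial>f/\<partial>x\<^sup>n) \<alpha>\<close>, by Cartan's formula for \<open>\<L>(\<xi>)\<alpha>\<close>.
\<close>

definition contact_field_op :: "nat \<Rightarrow> nat \<Rightarrow> diffop" where
  "contact_field_op p r =
    (if r \<le> p then - diffop_d (r + p)
     else if r \<le> 2 * p then diffop_d (r - p) + diffop_const (coord r) * diffop_d (2 * p + 1)
     else 1 - (\<Sum>a=1..p. diffop_const (coord (a + p)) * diffop_d (a + p)))"

lemma sum_contact_indices:
  fixes f :: "nat \<Rightarrow> 'a::comm_monoid_add"
  shows "(\<Sum>r=1..2 * p + 1. f r) = (\<Sum>a=1..p. f a) + (\<Sum>a=1..p. f (a + p)) + f (2 * p + 1)"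
proof -
  have "{1..2 * p} = {1..p} \<union> {1 + p..p + p}" "{1..p} \<inter> {1 + p..p + p} = {}" by auto
  then have "(\<Sum>r=1..2 * p. f r) = (\<Sum>a=1..p. f a) + (\<Sum>r=1 + p..p + p. f r)"
    by (simp add: sum.union_disjoint)
  then show ?thesis
    by (simp only: sum.shift_bounds_cl_nat_ivl Suc_eq_plus1[symmetric] sum.atLeast_Suc_atMost
        sum.cl_ivl_Suc) simp
qed

text \<open>The equation \<open>\<alpha>(\<xi>) = f\<close>.\<close>

lemma contact_form_contact_field:
  "(\<Sum>r=1..2 * p + 1. diffop_const (contact_form p r) * contact_field_op p r) = 1"
  unfolding sum_contact_indices
  by (simp add: contact_form_def contact_field_op_def diffop_const_minus)

lemma lie_row_eq:
  assumes "r \<in> {1..n}"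
  shows "lie_row n \<alpha> i r = diffop_const (\<alpha> r) * diffop_d i + diffop_const (pd r (\<alpha> i))"
  using assms by (simp add: lie_row_def)

lemma contact_index_cases:
  fixes i :: nat
  assumes "i \<in> {1..2 * p + 1}"
  obtains "i \<in> {1..p}" | a where "a \<in> {1..p}" "i = a + p" | "i = 2 * p + 1"
proof -
  have "i \<in> {1..p} \<or> (i - p \<in> {1..p} \<and> i = (i - p) + p) \<or> i = 2 * p + 1"
    using assms by auto
  then show thesis using that by blast
qed

text \<open>
  The contraction of \<open>d\<alpha>\<close> with the field above: \<open>\<iota>\<^sub>\<xi> d\<alpha> = (\<partial>f/\<partial>x\<^sup>n) \<alpha> - df\<close>. Since \<open>d\<alpha> = \<Sum>\<^sub>a dx\<^sup>a \<and> dx\<^bsup>a+p\<^esup>\<close>, at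
  most one \<open>r\<close> contributes for each \<open>i\<close>.
\<close>

lemma contact_curl:
  assumes "i \<in> {1..2 * p + 1}"
  shows "(\<Sum>r=1..2 * p + 1. diffop_const (pd r (contact_form p i) - pd i (contact_form p r)) *
      contact_field_op p r) = diffop_const (contact_form p i) * diffop_d (2 * p + 1) - diffop_d i"
proof -
  show ?thesis using assms
  proof (cases rule: contact_index_cases)
    case 1
    have "diffop_const (pd r (contact_form p i) - pd i (contact_form p r)) * contact_field_op p r =
        (if r = i + p then - contact_field_op p r else 0)" if "r \<in> {1..2 * p + 1}" for r
      using 1 that by (auto simp: pd_contact_form diffop_const_minus)
    then have "(\<Sum>r=1..2 * p + 1. diffop_const (pd r (contact_form p i) - pd i (contact_form p r)) *
      contact_field_op p r) = (\<Sum>r=1..2 * p + 1. if r = i + p then - contact_field_op p r else 0)"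
      by (intro sum.cong refl)
    also have "\<dots> = - contact_field_op p (i + p)"
      using 1 by (subst sum.delta) auto
    finally show ?thesis
      using 1 by (simp add: contact_field_op_def contact_form_def diffop_const_minus)
  next
    case (2 a)
    have "diffop_const (pd r (contact_form p i) - pd i (contact_form p r)) * contact_field_op p r =
        (if r = a then contact_field_op p r else 0)" if "r \<in> {1..2 * p + 1}" for r
      using 2 that by (auto simp: pd_contact_form diffop_const_minus)
    then have "(\<Sum>r=1..2 * p + 1. diffop_const (pd r (contact_form p i) - pd i (contact_form p r)) *
      contact_field_op p r) = (\<Sum>r=1..2 * p + 1. if r = a then contact_field_op p r else 0)"
      by (intro sum.cong refl)
    also have "\<dots> = contact_field_op p a"
      using 2 by (subst sum.delta) auto
    finally show ?thesis
      using 2 by (simp add: contact_field_op_def contact_form_def diffop_const_minus)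
  next
    case 3
    then have "pd r (contact_form p i) - pd i (contact_form p r) = 0" for r
      by (simp add: pd_contact_form)
    then show ?thesis
      using 3 by (simp add: contact_form_def)
  qed
qed

text \<open>
  The identity \<open>\<L>(\<xi>)\<alpha> = (\<partial>f/\<partial>x\<^sup>n) \<alpha>\<close>, obtained from Cartan's formula
  \<open>\<L>(\<xi>)\<alpha> = d(\<alpha>(\<xi>)) + \<iota>\<^sub>\<xi> d\<alpha>\<close>: commuting \<open>d\<^sub>i\<close> past \<open>\<alpha>\<^sub>r\<close> turns row \<open>i\<close> into \<open>d\<^sub>i\<alpha>\<^sub>r + (\<partial>\<^sub>r\<alpha>\<^sub>i - \<partial>\<^sub>i\<alpha>\<^sub>r)\<close>.
\<close>

lemma lie_row_contact_field:
  assumes "i \<in> {1..2 * p + 1}"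
  shows "(\<Sum>r=1..2 * p + 1. diffop_mult (lie_row (2 * p + 1) (contact_form p) i r) (contact_field_op p r))
    = diffop_const (contact_form p i) * diffop_d (2 * p + 1)"
proof -
  have "(\<Sum>r=1..2 * p + 1. diffop_mult (lie_row (2 * p + 1) (contact_form p) i r) (contact_field_op p r))
    = (\<Sum>r=1..2 * p + 1. diffop_mult (diffop_d i) (diffop_const (contact_form p r) * contact_field_op p r)
       + diffop_const (pd r (contact_form p i) - pd i (contact_form p r)) * contact_field_op p r)"
  proof (rule sum.cong[OF refl])
    fix r assume r: "r \<in> {1..2 * p + 1}"
    show "diffop_mult (lie_row (2 * p + 1) (contact_form p) i r) (contact_field_op p r) =
       diffop_mult (diffop_d i) (diffop_const (contact_form p r) * contact_field_op p r)
       + diffop_const (pd r (contact_form p i) - pd i (contact_form p r)) * contact_field_op p r"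
      unfolding lie_row_eq[OF r]
      by (simp add: diffop_mult_add_left diffop_mult_const_left diffop_mult_d d_mult_const
          diffop_const_diff left_diff_distrib)
  qed
  also have "\<dots> = diffop_mult (diffop_d i) (\<Sum>r=1..2 * p + 1. diffop_const (contact_form p r) * contact_field_op p r)
     + (\<Sum>r=1..2 * p + 1. diffop_const (pd r (contact_form p i) - pd i (contact_form p r)) * contact_field_op p r)"
    by (simp only: sum.distrib diffop_mult_sum_right)
  also have "\<dots> = diffop_d i + (diffop_const (contact_form p i) * diffop_d (2 * p + 1) - diffop_d i)"
    unfolding contact_form_contact_field contact_curl[OF assms] diffop_mult_1_right ..
  finally show ?thesis by simp
qed


lemma contact_form_ratfuns: "contact_form p i \<in> ratfuns (2 * p + 1)"
  unfolding contact_form_def by (auto simp del: One_nat_def intro!: ratfuns_uminus ratfuns_coord)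

lemma contact_field_op_carrier:
  assumes "r \<in> {1..2 * p + 1}"
  shows "contact_field_op p r \<in> carrier (diffop_ring (2 * p + 1))"
proof -
  have d: "diffop_d i \<in> carrier (diffop_ring (2 * p + 1))" if "1 \<le> i" "i \<le> 2 * p + 1" for i
    using that by (intro diffop_carrier_d) simp
  have c: "diffop_const (coord i) \<in> carrier (diffop_ring (2 * p + 1))" if "1 \<le> i" "i \<le> 2 * p + 1" for i
    using that by (intro diffop_carrier_const ratfuns_coord) simp
  have one: "1 \<in> carrier (diffop_ring (2 * p + 1))"
    using diffop_carrier_const[of 1 "2 * p + 1"] by simp
  have "1 + - (\<Sum>a=1..p. diffop_const (coord (a + p)) * diffop_d (a + p)) \<in> carrier (diffop_ring (2 * p + 1))"
    by (intro diffop_carrier_add one diffop_carrier_uminus diffop_carrier_sum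
        diffop_carrier_symbol_mult c d) simp_all
  moreover have "- diffop_d (r + p) \<in> carrier (diffop_ring (2 * p + 1))" if "r \<le> p"
    using that assms by (intro diffop_carrier_uminus d) simp_all
  moreover have "diffop_d (r - p) + diffop_const (coord r) * diffop_d (2 * p + 1)
      \<in> carrier (diffop_ring (2 * p + 1))" if "\<not> r \<le> p" "r \<le> 2 * p"
    using that by (intro diffop_carrier_add diffop_carrier_symbol_mult c d) simp_all
  ultimately show ?thesis
    by (simp add: contact_field_op_def del: One_nat_def)
qed

lemma power_module_simps:
  "carrier (power_module R I) = I \<rightarrow>\<^sub>E carrier R"
  "x \<oplus>\<^bsub>power_module R I\<^esub> y = (\<lambda>i\<in>I. x i \<oplus>\<^bsub>R\<^esub> y i)"
  "a \<odot>\<^bsub>power_module R I\<^esub> x = (\<lambda>i\<in>I. a \<otimes>\<^bsub>R\<^esub> x i)"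
  "\<zero>\<^bsub>power_module R I\<^esub> = (\<lambda>i\<in>I. \<zero>\<^bsub>R\<^esub>)"
  by (simp_all add: power_module_def)

lemma lie_row_carrier:
  assumes "i \<in> {1..n}" "\<And>r. \<alpha> r \<in> ratfuns n"
  shows "lie_row n \<alpha> i \<in> carrier (power_module (diffop_ring n) {1..n})"
  using assms diffop_carrier_d[OF assms(1)]
  by (auto simp: lie_row_def power_module_simps simp del: diffop_mult_const
      intro!: diffop_carrier_add diffop_carrier_mult diffop_carrier_const)

lemma proportional_row_eq:
  assumes "i \<in> {1..n}" "j \<in> {1..n}" "\<And>r. \<alpha> r \<in> ratfuns n"
  shows "proportional_row n \<alpha> i j \<in> carrier (power_module (diffop_ring n) {1..n})"
    and "proportional_row n \<alpha> i j =
      (\<lambda>k\<in>{1..n}. diffop_const (\<alpha> j) * lie_row n \<alpha> i k - diffop_const (\<alpha> i) * lie_row n \<alpha> j k)"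
proof -
  let ?F = "power_module (diffop_ring n) {1..n}"
  interpret F: left_module "diffop_ring n" ?F
    by (rule left_module_power[OF ring_diffop_ring])
  let ?x = "diffop_const (\<alpha> j) \<odot>\<^bsub>?F\<^esub> lie_row n \<alpha> i" and ?y = "diffop_const (\<alpha> i) \<odot>\<^bsub>?F\<^esub> lie_row n \<alpha> j"
  have xy: "?x \<in> carrier ?F" "?y \<in> carrier ?F"
    using assms by (intro F.lsmult_closed diffop_carrier_const lie_row_carrier; simp)+
  have row: "proportional_row n \<alpha> i j = ?x \<ominus>\<^bsub>?F\<^esub> ?y"
    by (simp add: proportional_row_def Let_def)
  show carrier: "proportional_row n \<alpha> i j \<in> carrier ?F"
    unfolding row using xy by (rule F.M.minus_closed)
  have sum: "proportional_row n \<alpha> i j \<oplus>\<^bsub>?F\<^esub> ?y = ?x"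
    unfolding row using xy by (rule F.M.minus_add_cancel_right)
  have "proportional_row n \<alpha> i j k =
      diffop_const (\<alpha> j) * lie_row n \<alpha> i k - diffop_const (\<alpha> i) * lie_row n \<alpha> j k" if "k \<in> {1..n}" for k
    using fun_cong[OF sum, of k] that by (simp add: power_module_simps eq_diff_eq)
  moreover have "proportional_row n \<alpha> i j \<in> extensional {1..n}"
    using carrier by (simp add: power_module_simps PiE_def)
  ultimately show "proportional_row n \<alpha> i j =
      (\<lambda>k\<in>{1..n}. diffop_const (\<alpha> j) * lie_row n \<alpha> i k - diffop_const (\<alpha> i) * lie_row n \<alpha> j k)"
    by (intro extensionalityI[of _ "{1..n}"]) auto
qed

text \<open>
  The row of \<open>\<xi>\<^sup>r - Q\<^sub>r \<alpha>(\<xi>)\<close> with \<open>Q\<^sub>r = contact_field_op p r\<close>. That these rows are consequences of the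
  contact equations means that a contact field is recovered from \<open>f = \<alpha>(\<xi>)\<close>.
\<close>

definition residual_row :: "nat \<Rightarrow> nat \<Rightarrow> nat \<Rightarrow> diffop" where
  "residual_row p r = (\<lambda>k\<in>{1..2 * p + 1}.
     (if k = r then 1 else 0) - diffop_mult (contact_field_op p r) (diffop_const (contact_form p k)))"

lemma d_contact_form:
  "diffop_mult (diffop_d i) (diffop_const (contact_form p k)) =
    diffop_const (contact_form p k) * diffop_d i - (if k \<in> {1..p} \<and> i = k + p then 1 else 0)"
  by (simp add: d_const pd_contact_form diffop_const_minus)

lemma lie_row_contact_form:
  assumes "k \<in> {1..2 * p + 1}"
  shows "lie_row (2 * p + 1) (contact_form p) i k =
    diffop_const (contact_form p k) * diffop_d i - (if i \<in> {1..p} \<and> k = i + p then 1 else 0)"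
  unfolding lie_row_eq[OF assms] by (simp add: pd_contact_form diffop_const_minus)

lemma residual_row_lower:
  assumes "a \<in> {1..p}"
  shows "residual_row p a = proportional_row (2 * p + 1) (contact_form p) (a + p) (2 * p + 1)"
proof -
  have "proportional_row (2 * p + 1) (contact_form p) (a + p) (2 * p + 1) =
    (\<lambda>k\<in>{1..2 * p + 1}. diffop_const (contact_form p (2 * p + 1)) * lie_row (2 * p + 1) (contact_form p) (a + p) k
      - diffop_const (contact_form p (a + p)) * lie_row (2 * p + 1) (contact_form p) (2 * p + 1) k)"
    using assms by (intro proportional_row_eq(2) contact_form_ratfuns) auto
  also have "\<dots> = residual_row p a"
    unfolding residual_row_def
  proof (rule restrict_ext)
    fix k assume k: "k \<in> {1..2 * p + 1}"
    have \<alpha>: "contact_form p (2 * p + 1) = 1" "contact_form p (a + p) = 0"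
      using assms by (simp_all add: contact_form_def)
    have Q: "contact_field_op p a = - diffop_d (a + p)"
      using assms by (simp add: contact_field_op_def)
    show "diffop_const (contact_form p (2 * p + 1)) * lie_row (2 * p + 1) (contact_form p) (a + p) k
      - diffop_const (contact_form p (a + p)) * lie_row (2 * p + 1) (contact_form p) (2 * p + 1) k
      = (if k = a then 1 else 0) - diffop_mult (contact_field_op p a) (diffop_const (contact_form p k))"
      unfolding \<alpha> Q lie_row_contact_form[OF k] diffop_mult_minus_left d_contact_form
      using assms by auto
  qed
  finally show ?thesis by (rule sym)
qed

lemma residual_row_upper:
  assumes "a \<in> {1..p}"
  shows "residual_row p (a + p) = proportional_row (2 * p + 1) (contact_form p) (2 * p + 1) a"
proof -
  have "proportional_row (2 * p + 1) (contact_form p) (2 * p + 1) a =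
    (\<lambda>k\<in>{1..2 * p + 1}. diffop_const (contact_form p a) * lie_row (2 * p + 1) (contact_form p) (2 * p + 1) k
      - diffop_const (contact_form p (2 * p + 1)) * lie_row (2 * p + 1) (contact_form p) a k)"
    using assms by (intro proportional_row_eq(2) contact_form_ratfuns) auto
  also have "\<dots> = residual_row p (a + p)"
    unfolding residual_row_def
  proof (rule restrict_ext)
    fix k assume k: "k \<in> {1..2 * p + 1}"
    have \<alpha>: "contact_form p (2 * p + 1) = 1" "contact_form p a = - coord (a + p)"
      using assms by (simp_all add: contact_form_def)
    have Q: "contact_field_op p (a + p) = diffop_d a + diffop_const (coord (a + p)) * diffop_d (2 * p + 1)"
      using assms by (simp add: contact_field_op_def)
    show "diffop_const (contact_form p a) * lie_row (2 * p + 1) (contact_form p) (2 * p + 1) k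
      - diffop_const (contact_form p (2 * p + 1)) * lie_row (2 * p + 1) (contact_form p) a k
      = (if k = a + p then 1 else 0) - diffop_mult (contact_field_op p (a + p)) (diffop_const (contact_form p k))"
      unfolding \<alpha> Q lie_row_contact_form[OF k] diffop_mult_add_left diffop_mult_const_left d_contact_form
        diffop_const_minus
      using assms by auto
  qed
  finally show ?thesis by (rule sym)
qed

text \<open>
  Since \<open>\<alpha>\<^sub>n = 1\<close>, the component \<open>\<xi>\<^sup>n\<close> is \<open>\<alpha>(\<xi>) + \<Sum>\<^sub>a x\<^bsup>a+p\<^esup> \<xi>\<^sup>a\<close>, so its residual is a combination of those of
  the \<open>\<xi>\<^sup>a\<close>.
\<close>

lemma residual_row_last:
  "residual_row p (2 * p + 1) =
    (\<lambda>k\<in>{1..2 * p + 1}. \<Sum>a=1..p. diffop_const (coord (a + p)) * residual_row p a k)"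
  unfolding residual_row_def[of p "2 * p + 1"]
proof (rule restrict_ext)
  fix k assume k: "k \<in> {1..2 * p + 1}"
  let ?c = "\<lambda>a. diffop_const (coord (a + p))" and ?k = "diffop_const (contact_form p k)"
  have Q: "contact_field_op p (2 * p + 1) = 1 - (\<Sum>a=1..p. ?c a * diffop_d (a + p))"
    by (simp add: contact_field_op_def)
  have res: "residual_row p a k = (if k = a then 1 else 0) + diffop_mult (diffop_d (a + p)) ?k"
    if "a \<in> {1..p}" for a
    using that k by (simp add: residual_row_def contact_field_op_def diffop_mult_minus_left)
  have "(\<Sum>a=1..p. ?c a * residual_row p a k) =
      (\<Sum>a=1..p. (if k = a then ?c a else 0) + diffop_mult (?c a * diffop_d (a + p)) ?k)"
    by (intro sum.cong refl) (simp add: res diffop_mult_const_left ring_distribs)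
  also have "\<dots> = (\<Sum>a=1..p. if k = a then ?c a else 0)
      + diffop_mult (\<Sum>a=1..p. ?c a * diffop_d (a + p)) ?k"
    by (simp only: sum.distrib diffop_mult_sum_left)
  also have "(\<Sum>a=1..p. if k = a then ?c a else 0) = (if k = 2 * p + 1 then 1 else 0) - ?k"
    using k by (subst sum.delta') (auto simp: contact_form_def diffop_const_minus)
  finally show "(if k = 2 * p + 1 then 1 else 0) - diffop_mult (contact_field_op p (2 * p + 1)) ?k =
      (\<Sum>a=1..p. ?c a * residual_row p a k)"
    unfolding Q diffop_mult_diff_left diffop_mult_1_left by simp
qed

lemma submodule_power_sum:
  fixes n :: nat and S :: "'s set"
  defines "F \<equiv> power_module (diffop_ring n) {1..n}"
  assumes H: "submodule H (diffop_ring n) F" and v: "\<And>s. s \<in> S \<Longrightarrow> v s \<in> H" and "finite S"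
    and c: "\<And>s. s \<in> S \<Longrightarrow> c s \<in> carrier (diffop_ring n)"
  shows "(\<lambda>k\<in>{1..n}. \<Sum>s\<in>S. diffop_mult (c s) (v s k)) \<in> H"
  using \<open>finite S\<close> v c
proof (induction S rule: finite_induct)
  case empty
  have "\<zero>\<^bsub>F\<^esub> \<in> H"
    using subgroup.one_closed[OF submodule.axioms(1)[OF H]] by simp
  then show ?case by (simp only: F_def power_module_simps diffop_ring_simps sum.empty)
next
  case (insert s S)
  have "c s \<odot>\<^bsub>F\<^esub> v s \<in> H"
    using insert.prems by (intro submodule.smult_closed[OF H]) auto
  moreover have "(\<lambda>k\<in>{1..n}. \<Sum>s\<in>S. diffop_mult (c s) (v s k)) \<in> H"
    by (intro insert.IH insert.prems insertI2)
  ultimately have "c s \<odot>\<^bsub>F\<^esub> v s \<oplus>\<^bsub>F\<^esub> (\<lambda>k\<in>{1..n}. \<Sum>s\<in>S. diffop_mult (c s) (v s k)) \<in> H"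
    using subgroup.m_closed[OF submodule.axioms(1)[OF H]] by (simp only: monoid.simps)
  also have "c s \<odot>\<^bsub>F\<^esub> v s \<oplus>\<^bsub>F\<^esub> (\<lambda>k\<in>{1..n}. \<Sum>s\<in>S. diffop_mult (c s) (v s k)) =
      (\<lambda>k\<in>{1..n}. \<Sum>s\<in>insert s S. diffop_mult (c s) (v s k))"
    using insert.hyps by (auto simp: F_def power_module_simps intro!: restrict_ext)
  finally show ?case .
qed

abbreviation contact_relations :: "nat \<Rightarrow> (nat \<Rightarrow> diffop) set" where
  "contact_relations p \<equiv>
    {proportional_row (2 * p + 1) (contact_form p) i j | i j. i \<in> {1..2 * p + 1} \<and> j \<in> {1..2 * p + 1}}"

text \<open>
  The residuals of \<open>\<xi>\<^sup>a\<close> and \<open>\<xi>\<^bsup>a+p\<^esup>\<close> are themselves contact equations, up to sign those with indices \<open>(a + p, n)\<close> and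
  \<open>(a, n)\<close>.
\<close>

lemma residual_row_mem:
  assumes r: "r \<in> {1..2 * p + 1}"
    and H: "submodule H (diffop_ring (2 * p + 1)) (power_module (diffop_ring (2 * p + 1)) {1..2 * p + 1})"
    and rel: "contact_relations p \<subseteq> H"
  shows "residual_row p r \<in> H"
proof -
  have lower: "residual_row p a \<in> H" if "a \<in> {1..p}" for a
  proof -
    have "a + p \<in> {1..2 * p + 1}" "2 * p + 1 \<in> {1..2 * p + 1}" using that by auto
    then show ?thesis unfolding residual_row_lower[OF that] using rel by blast
  qed
  show ?thesis using r
  proof (cases rule: contact_index_cases)
    case 1
    then show ?thesis by (rule lower)
  next
    case (2 a)
    have "a \<in> {1..2 * p + 1}" "2 * p + 1 \<in> {1..2 * p + 1}" using 2 by auto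
    then show ?thesis unfolding 2(2) residual_row_upper[OF 2(1)] using rel by blast
  next
    case 3
    have "(\<lambda>k\<in>{1..2 * p + 1}. \<Sum>a=1..p. diffop_mult (diffop_const (coord (a + p))) (residual_row p a k)) \<in> H"
      by (intro submodule_power_sum H lower diffop_carrier_const ratfuns_coord) auto
    then show ?thesis
      unfolding 3 residual_row_last by (simp only: diffop_mult_const)
  qed
qed

text \<open>
  Substituting \<open>\<xi>\<^sup>r = Q\<^sub>r f\<close> into a linear expression \<open>\<Sum>\<^sub>r x\<^sub>r \<xi>\<^sup>r\<close> gives the operator \<open>\<Sum>\<^sub>r x\<^sub>r Q\<^sub>r\<close> on \<open>f\<close>.
\<close>

definition contact_parametrization :: "nat \<Rightarrow> (nat \<Rightarrow> diffop) \<Rightarrow> diffop" where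
  "contact_parametrization p = (\<lambda>x\<in>carrier (power_module (diffop_ring (2 * p + 1)) {1..2 * p + 1}).
     \<Sum>r=1..2 * p + 1. diffop_mult (x r) (contact_field_op p r))"

lemma contact_parametrization_map:
  "left_module_map (diffop_ring (2 * p + 1)) (power_module (diffop_ring (2 * p + 1)) {1..2 * p + 1})
     (regular_module (diffop_ring (2 * p + 1))) (contact_parametrization p)"
    (is "left_module_map ?D ?F ?N _")
proof (rule left_module_mapI)
  show F: "left_module ?D ?F" by (rule left_module_power[OF ring_diffop_ring])
  show N: "left_module ?D ?N" by (rule left_module_regular[OF ring_diffop_ring])
  interpret F: left_module ?D ?F by (rule F)
  have reg: "carrier ?N = carrier ?D" "x \<oplus>\<^bsub>?N\<^esub> y = x + y" "x \<odot>\<^bsub>?N\<^esub> y = diffop_mult x y" for x y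
    by (simp_all add: regular_module_def)
  show "contact_parametrization p \<in> left_module_hom ?D ?F ?N"
  proof (rule left_module_homI)
    show "contact_parametrization p \<in> carrier ?F \<rightarrow>\<^sub>E carrier ?N"
    proof (rule PiE_I)
      fix x assume x: "x \<in> carrier ?F"
      then have "diffop_mult (x r) (contact_field_op p r) \<in> carrier ?D" if "r \<in> {1..2 * p + 1}" for r
        using that by (intro diffop_carrier_mult contact_field_op_carrier)
          (auto simp: power_module_simps simp del: One_nat_def)
      then have "(\<Sum>r=1..2 * p + 1. diffop_mult (x r) (contact_field_op p r)) \<in> carrier ?D"
        by (rule diffop_carrier_sum)
      then show "contact_parametrization p x \<in> carrier ?N"
        using x by (simp only: reg contact_parametrization_def restrict_apply if_True)
    qed (simp add: contact_parametrization_def)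
  next
    fix x y assume xy: "x \<in> carrier ?F" "y \<in> carrier ?F"
    have "(\<Sum>r=1..2 * p + 1. diffop_mult ((x \<oplus>\<^bsub>?F\<^esub> y) r) (contact_field_op p r)) =
        (\<Sum>r=1..2 * p + 1. diffop_mult (x r) (contact_field_op p r) + diffop_mult (y r) (contact_field_op p r))"
      by (intro sum.cong refl) (simp add: power_module_simps diffop_mult_add_left)
    then show "contact_parametrization p (x \<oplus>\<^bsub>?F\<^esub> y) =
        contact_parametrization p x \<oplus>\<^bsub>?N\<^esub> contact_parametrization p y"
      using xy F.M.a_closed[OF xy]
      by (simp only: reg contact_parametrization_def restrict_apply if_True sum.distrib)
  next
    fix a x assume a: "a \<in> carrier ?D" and x: "x \<in> carrier ?F"
    have "(\<Sum>r=1..2 * p + 1. diffop_mult ((a \<odot>\<^bsub>?F\<^esub> x) r) (contact_field_op p r)) =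
        (\<Sum>r=1..2 * p + 1. diffop_mult a (diffop_mult (x r) (contact_field_op p r)))"
      by (intro sum.cong refl) (simp add: power_module_simps diffop_mult_assoc)
    then show "contact_parametrization p (a \<odot>\<^bsub>?F\<^esub> x) = a \<odot>\<^bsub>?N\<^esub> contact_parametrization p x"
      using x F.lsmult_closed[OF a x]
      by (simp only: reg contact_parametrization_def restrict_apply if_True diffop_mult_sum_right)
  qed
qed

text \<open>
  On parametrized fields \<open>\<L>(\<xi>)\<alpha>\<close> has the components \<open>\<alpha>\<^sub>i \<partial>f/\<partial>x\<^sup>n\<close>, and \<open>\<alpha>\<^sub>j \<alpha>\<^sub>i - \<alpha>\<^sub>i \<alpha>\<^sub>j = 0\<close>.
\<close>

lemma contact_parametrization_relation:
  assumes i: "i \<in> {1..2 * p + 1}" and j: "j \<in> {1..2 * p + 1}"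
  shows "contact_parametrization p (proportional_row (2 * p + 1) (contact_form p) i j) = 0"
proof -
  let ?n = "2 * p + 1" and ?\<alpha> = "contact_form p"
  note row = proportional_row_eq[OF i j contact_form_ratfuns]
  have "contact_parametrization p (proportional_row ?n ?\<alpha> i j) =
      (\<Sum>r=1..?n. diffop_mult (proportional_row ?n ?\<alpha> i j r) (contact_field_op p r))"
    using row(1) by (simp only: contact_parametrization_def restrict_apply if_True)
  also have "\<dots> = (\<Sum>r=1..?n. diffop_const (?\<alpha> j) * diffop_mult (lie_row ?n ?\<alpha> i r) (contact_field_op p r)
      - diffop_const (?\<alpha> i) * diffop_mult (lie_row ?n ?\<alpha> j r) (contact_field_op p r))"
    by (intro sum.cong refl)
      (simp only: row(2) restrict_apply if_True diffop_mult_diff_left diffop_mult_const_left)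
  also have "\<dots> = diffop_const (?\<alpha> j) * (\<Sum>r=1..?n. diffop_mult (lie_row ?n ?\<alpha> i r) (contact_field_op p r))
      - diffop_const (?\<alpha> i) * (\<Sum>r=1..?n. diffop_mult (lie_row ?n ?\<alpha> j r) (contact_field_op p r))"
    by (simp only: sum_subtractf sum_distrib_left)
  also have "\<dots> = 0"
    unfolding lie_row_contact_field[OF i] lie_row_contact_field[OF j] by (simp add: mult.left_commute)
  finally show ?thesis .
qed

text \<open>
  The element \<open>m\<close> is the class of \<open>\<alpha>(\<xi>)\<close> and \<open>g\<close> is induced by the substitution \<open>\<xi>\<^sup>r = Q\<^sub>r f\<close>. The identity
  \<open>x = \<Sum>\<^sub>r x\<^sub>r (e\<^sub>r - Q\<^sub>r \<alpha>) + (\<Sum>\<^sub>r x\<^sub>r Q\<^sub>r) \<alpha>\<close> in the free module \<open>D\<^sup>n\<close>, whose first part lies in the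
  submodule of relations, gives \<open>C = g(C) m\<close>.
\<close>

lemma contact_module_dual_basis:
  fixes p :: nat
  defines "D \<equiv> diffop_ring (2 * p + 1)"
  shows "\<exists>g m. left_module_map D (contact_module p) (regular_module D) g \<and> m \<in> carrier (contact_module p) \<and>
    (\<forall>C\<in>carrier (contact_module p). g C \<odot>\<^bsub>contact_module p\<^esub> m = C)"
proof -
  define F where "F = power_module D {1..2 * p + 1}"
  define H where "H = generated_submodule D F (contact_relations p)"
  have Q: "contact_module p = quotient_module F H"
    by (simp only: contact_module_def conformal_module_def Let_def H_def F_def D_def)
  have F: "left_module D F"
    unfolding F_def D_def by (rule left_module_power[OF ring_diffop_ring])
  interpret F: left_module D F by (rule F)
  have rel: "contact_relations p \<subseteq> carrier F"
    using proportional_row_eq(1)[where \<alpha> = "contact_form p", OF _ _ contact_form_ratfuns]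
    unfolding F_def D_def by blast
  have H: "submodule H D F"
    unfolding H_def by (rule submodule_generated_submodule[OF F rel])
  interpret \<Phi>: left_module_map D F "regular_module D" "contact_parametrization p"
    unfolding F_def D_def by (rule contact_parametrization_map)
  have "contact_relations p \<subseteq> a_kernel F (regular_module D) (contact_parametrization p)"
  proof
    fix x assume x: "x \<in> contact_relations p"
    then have "x \<in> carrier F" using rel by blast
    moreover have "contact_parametrization p x = 0"
      using x contact_parametrization_relation by blast
    then have "contact_parametrization p x = \<zero>\<^bsub>regular_module D\<^esub>"
      by (simp add: regular_module_def D_def)
    ultimately show "x \<in> a_kernel F (regular_module D) (contact_parametrization p)"
      by (intro iffD2[OF mem_a_kernel] conjI)
  qed
  then have "H \<subseteq> a_kernel F (regular_module D) (contact_parametrization p)"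
    unfolding H_def by (rule generated_submodule_least[OF \<Phi>.kernel_submodule])
  from quotient_module_induced_hom[OF F H \<Phi>.left_module_map_axioms this]
  obtain g where g: "g \<in> left_module_hom D (quotient_module F H) (regular_module D)"
    and g_coset: "\<And>x. x \<in> carrier F \<Longrightarrow> g (H +>\<^bsub>F\<^esub> x) = contact_parametrization p x"
    by blast
  define \<alpha> where "\<alpha> = (\<lambda>k\<in>{1..2 * p + 1}. diffop_const (contact_form p k))"
  have \<alpha>: "\<alpha> \<in> carrier F"
    unfolding F_def power_module_simps \<alpha>_def D_def
    by (auto intro!: diffop_carrier_const contact_form_ratfuns simp del: One_nat_def)
  have dual: "g C \<odot>\<^bsub>quotient_module F H\<^esub> (H +>\<^bsub>F\<^esub> \<alpha>) = C" if "C \<in> carrier (quotient_module F H)" for C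
  proof -
    obtain x where x: "x \<in> carrier F" and C: "C = H +>\<^bsub>F\<^esub> x"
      using \<open>C \<in> _\<close> unfolding quotient_module_carrier[OF F H] by blast
    let ?\<Phi>x = "contact_parametrization p x"
    have \<Phi>x: "?\<Phi>x \<in> carrier D"
      using \<Phi>.closed[OF x] by (simp add: regular_module_def)
    have x_D: "x r \<in> carrier D" if "r \<in> {1..2 * p + 1}" for r
      using x that by (auto simp: F_def power_module_simps simp del: One_nat_def)
    \<comment> \<open>the part \<open>\<Sum>\<^sub>r x\<^sub>r (e\<^sub>r - Q\<^sub>r \<alpha>)\<close>\<close>
    define h where "h = (\<lambda>k\<in>{1..2 * p + 1}. \<Sum>r=1..2 * p + 1. diffop_mult (x r) (residual_row p r k))"
    have "h \<in> H"
      unfolding h_def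
    proof (rule submodule_power_sum)
      show "submodule H (diffop_ring (2 * p + 1)) (power_module (diffop_ring (2 * p + 1)) {1..2 * p + 1})"
        using H by (simp only: F_def D_def)
      then show "residual_row p r \<in> H" if "r \<in> {1..2 * p + 1}" for r
        using generated_submodule_generator[of _ "contact_relations p" D F]
        by (intro residual_row_mem[OF that]) (auto simp only: H_def)
    qed (use x_D in \<open>simp_all only: D_def finite_atLeastAtMost\<close>)
    moreover have "x = h \<oplus>\<^bsub>F\<^esub> (?\<Phi>x \<odot>\<^bsub>F\<^esub> \<alpha>)"
    proof (rule extensionalityI[of _ "{1..2 * p + 1}"])
      fix k assume k: "k \<in> {1..2 * p + 1}"
      have "h k = (\<Sum>r=1..2 * p + 1. (if k = r then x r else 0)
          - diffop_mult (diffop_mult (x r) (contact_field_op p r)) (diffop_const (contact_form p k)))"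
        using k unfolding h_def restrict_apply
        by (simp only: if_True)
          (auto intro!: sum.cong simp: residual_row_def diffop_mult_diff_right diffop_mult_assoc diffop_mult_1_right)
      also have "\<dots> = x k - diffop_mult (\<Sum>r=1..2 * p + 1. diffop_mult (x r) (contact_field_op p r))
          (diffop_const (contact_form p k))"
        using k by (simp only: sum_subtractf diffop_mult_sum_left sum.delta' finite_atLeastAtMost if_True)
      also have "(\<Sum>r=1..2 * p + 1. diffop_mult (x r) (contact_field_op p r)) = ?\<Phi>x"
        using x unfolding F_def D_def by (simp only: contact_parametrization_def restrict_apply if_True)
      finally show "x k = (h \<oplus>\<^bsub>F\<^esub> (?\<Phi>x \<odot>\<^bsub>F\<^esub> \<alpha>)) k"
        using k by (simp add: F_def power_module_simps \<alpha>_def D_def)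
    qed (use x in \<open>simp_all add: F_def power_module_simps PiE_def\<close>)
    ultimately have coset: "H +>\<^bsub>F\<^esub> x = H +>\<^bsub>F\<^esub> (?\<Phi>x \<odot>\<^bsub>F\<^esub> \<alpha>)"
      by (intro coset_eqI[OF F H] F.lsmult_closed \<Phi>x \<alpha>)
    show ?thesis
      unfolding C g_coset[OF x] quotient_module_smult[OF F H \<Phi>x \<alpha>] by (rule coset[symmetric])
  qed
  moreover have "H +>\<^bsub>F\<^esub> \<alpha> \<in> carrier (quotient_module F H)"
    unfolding quotient_module_carrier[OF F H] using \<alpha> by (rule imageI)
  moreover have "left_module_map D (quotient_module F H) (regular_module D) g"
    by (intro left_module_mapI left_module_quotient[OF F H] \<Phi>.N.left_module_axioms g)
  ultimately show ?thesis
    unfolding Q by blast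
qed

theorem mainTheorem2:
  fixes p n i :: nat
    and P :: "nat \<Rightarrow> (diffop, 'c) module"
    and \<delta> :: "nat \<Rightarrow> 'c \<Rightarrow> 'c"
    and \<epsilon> :: "'c \<Rightarrow> (nat \<Rightarrow> diffop) set"
  assumes "p \<ge> 1"
    and "n = 2 * p + 1"
    and "free_resolution (diffop_ring n) (contact_module p) P \<delta> \<epsilon>"
    and "i \<ge> 1"
  shows "trivial_group (ext_group (diffop_ring n) P \<delta> (regular_module (diffop_ring n)) i)"
proof -
  have M: "left_module (diffop_ring n) (contact_module p)"
    unfolding assms(2) by (rule left_module_contact_module)
  obtain g m where g: "left_module_map (diffop_ring n) (contact_module p) (regular_module (diffop_ring n)) g"
      and m: "m \<in> carrier (contact_module p)"
      and dual: "\<And>C. C \<in> carrier (contact_module p) \<Longrightarrow> g C \<odot>\<^bsub>contact_module p\<^esub> m = C"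
    using contact_module_dual_basis[of p] unfolding assms(2) by blast
  have surj: "\<epsilon> ` carrier (P 0) = carrier (contact_module p)"
    using assms(3) by (simp add: free_resolution_def)
  obtain s where "s \<in> left_module_hom (diffop_ring n) (contact_module p) (P 0)"
      "\<And>x. x \<in> carrier (contact_module p) \<Longrightarrow> \<epsilon> (s x) = x"
    using dual_basis_section[OF g m dual free_resolution_maps(2)[OF assms(3) M] surj] by blast
  then show ?thesis
    by (intro ext_group_trivial[OF assms(3) M left_module_regular[OF ring_diffop_ring]] assms(4))
qed

end
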